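(* Let $d\ge1$ be an integer, and let $a_d$ and the zeros $\tau_1<\tau_2<\dots$ be as defined in the context. Then for every $k\ge1$, $$a_d=\tau_k^d\prod_{\substack{j\ge1\\ j\ne k}}\Bigl|1-\frac{\tau_k^2}{\tau_j^2}\Bigr|.$$
   Context: Let $\mathrm{PW}_r^p(\mathbb R^d)$ be the Paley--Wiener class of functions of spherical exponential type at most $r$ belonging to $L^p(\mathbb R^d)$. The sharp Nikolskii constant $\mathcal C_d$ is defined by $\mathcal C_d^{-1}=\inf\{\|f\|_1: f\in \mathrm{PW}_1^1(\mathbb R^d),\ f(0)=1\}$. It is known that this problem has a unique radial extremal function $x\mapsto\varphi(|x|)$, where $\varphi=\varphi_d$ is an even entire function of exact exponential type $1$, bounded in modulus by one on $\mathbb R$; its positive zeros are $0<\tau_1<\tau_2<\dots$ ($\tau_k=\tau_{k,d}$), $\tau_k\sim\pi k$ as $k\to\infty$, and $\varphi(z)=\prod_{k\ge1}(1-z^2/\tau_k^2)$. It is also known that the extremality condition $g(0)=\frac{\mathcal C_d\omega_{d-1}}2\int_{\mathbb R}\sigma(x)g(x)|x|^{d-1}\,dx$ holds for every even entire function $g$ of exponential type at most $1$ with $|x|^{d-1}g(x)\in L^1(\mathbb R)$, where $\sigma(x)=\operatorname{sign}\varphi(x)$, $v_d$ is the volume of the unit ball of $\mathbb R^d$ and $\omega_{d-1}=dv_d$. Put $a_d=\frac1{2v_d\mathcal C_d}$. *)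

theory Defs
  imports "HOL-Analysis.Analysis" "HOL-Complex_Analysis.Complex_Analysis"
begin

definition entire_multi :: "(complex ^ 'n::finite \<Rightarrow> complex) \<Rightarrow> bool" where
  "entire_multi F \<longleftrightarrow>
     (\<forall>z. \<exists>F'. (F has_derivative F') (at z) \<and> (\<forall>c v. F' (c *s v) = c * F' v))"

(* The norm on complex ^ 'n is the Hermitian one, sqrt (sum of squared moduli). *)
definition spherical_exp_type_le :: "real \<Rightarrow> (complex ^ 'n::finite \<Rightarrow> complex) \<Rightarrow> bool" where
  "spherical_exp_type_le r F \<longleftrightarrow>
     (\<forall>\<epsilon>>0. \<exists>A. \<forall>z. norm (F z) \<le> A * exp ((r + \<epsilon>) * norm z))"

definition complexify :: "real ^ 'n::finite \<Rightarrow> complex ^ 'n" where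
  "complexify x = (\<chi> i. complex_of_real (x $ i))"

(* Finite exponents p only.  Elements are honest functions on R^d (the restrictions of the
   entire functions), so point values make sense. *)
definition PW :: "real \<Rightarrow> real \<Rightarrow> (real ^ 'n::finite \<Rightarrow> complex) set" where
  "PW r p = {f. (\<exists>F. entire_multi F \<and> spherical_exp_type_le r F \<and> (\<forall>x. f x = F (complexify x)))
               \<and> integrable lborel (\<lambda>x. norm (f x) powr p)}"

definition L1_norm :: "(real ^ 'n::finite \<Rightarrow> complex) \<Rightarrow> real" where
  "L1_norm f = (LINT x|lborel. norm (f x))"

definition nikolskii_admissible :: "(real ^ 'n::finite \<Rightarrow> complex) set" where
  "nikolskii_admissible = {f \<in> PW 1 1. f 0 = 1}"

(* The dimension d is CARD('n), passed through TYPE('n). *)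
definition nikolskii_const :: "'n::finite itself \<Rightarrow> real" where
  "nikolskii_const _ =
     inverse (INF f \<in> (nikolskii_admissible :: (real ^ 'n \<Rightarrow> complex) set). L1_norm f)"

definition nikolskii_extremal :: "(real ^ 'n::finite \<Rightarrow> complex) \<Rightarrow> bool" where
  "nikolskii_extremal f \<longleftrightarrow>
     f \<in> nikolskii_admissible \<and>
     (\<forall>g \<in> (nikolskii_admissible :: (real ^ 'n \<Rightarrow> complex) set). L1_norm f \<le> L1_norm g)"

definition a_const :: "'n::finite itself \<Rightarrow> real" where
  "a_const d = 1 / (2 * measure lborel (ball (0 :: real ^ 'n) 1) * nikolskii_const d)"

end

theory Submission
  imports Defs "HOL-Real_Asymp.Real_Asymp"
begin

text \<open>
  Since \<open>\<phi>\<close> is even, \<open>\<phi> z = f (z\<^sup>2)\<close> for an entire function \<open>f\<close>. Functions of exponential type at most 1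
  correspond to functions \<open>f\<close> with growth \<open>exp ((1 + \<epsilon>) * sqrt (norm w))\<close>, called radial profiles below;
  \<open>x \<mapsto> f (norm x ^ 2)\<close> is then the restriction of an entire function of spherical exponential type
  at most 1. Let \<open>d\<close> be the dimension and \<open>\<parallel>f\<parallel>\<close> the \<open>L\<^sup>1\<close> norm of the extremal function, so
  that the constant in question is \<open>\<parallel>f\<parallel>\<close> divided by twice the volume of the unit ball.

  Minimality gives the extremality condition (\<open>extremal_orthogonality\<close>): the integral of
  \<open>sgn f \<bullet> g\<close> over the whole space is \<open>Re (g 0) * \<parallel>f\<parallel>\<close>, for every integrable profile \<open>g\<close>. It is used twice.

  Fix a positive zero \<open>\<tau>\<close>, write \<open>f w = (1 - w / \<tau>\<^sup>2) * \<kappa> w\<close> and put \<open>\<Phi> r = r ^ d * \<kappa> (r\<^sup>2)\<close>.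
  Then \<open>\<Phi>' r = r ^ (d - 1) * G (r\<^sup>2)\<close> for a profile \<open>G\<close> with \<open>G 0 = d\<close>. For \<open>r > 0\<close> the sign of
  \<open>f (r\<^sup>2)\<close> is the sign of \<open>\<Phi> r\<close> up to \<open>\<tau>\<close> and its negative beyond, so in polar
  coordinates the condition for \<open>G\<close> integrates the derivative of the modulus of \<open>\<Phi>\<close>, with a change
  of sign at \<open>\<tau>\<close>. As \<open>\<Phi>\<close> vanishes at 0 and at all other zeros of \<open>\<phi>\<close>, the result is twice
  the modulus of \<open>\<Phi> \<tau>\<close>, and the constant equals \<open>\<tau> ^ d * norm (\<kappa> (\<tau>\<^sup>2))\<close>
  (\<open>extremal_quadrature\<close>). For \<open>G\<close> to be a legitimate test function, \<open>\<Phi>'\<close> has to be integrable; this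
  is a Bernstein inequality in \<open>L\<^sup>1\<close> (\<open>integrable_deriv_exp_type\<close>), proved with the
  Phragmen-Lindelof principle.

  The product formula for \<open>\<kappa> (\<tau>\<^sup>2)\<close> is Hadamard's theorem for functions of order 1/2
  (\<open>hadamard_product_simple_zeros\<close>). It requires that \<open>f\<close> has only the zeros \<open>\<tau> j ^ 2\<close>, all simple.
  A zero elsewhere would allow a test function that contradicts the extremality condition
  (\<open>extremal_zeros_positive\<close>), and the quadrature identity, whose left-hand side is positive, excludes
  \<open>\<kappa> (\<tau>\<^sup>2) = 0\<close>, hence multiple zeros.
\<close>

section \<open>The Phragmen-Lindelof principle for functions of exponential type\<close>

text \<open>
  The domain is cut off by a disc so large that the bound on its circle comes from the
  behaviour at infinity; the maximum principle then applies to the bounded piece.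
\<close>

lemma maximum_modulus_unbounded:
  fixes f :: "complex \<Rightarrow> complex"
  assumes U: "open U" and hol: "f holomorphic_on U" and cont: "continuous_on (closure U) f"
    and front: "\<And>z. z \<in> frontier U \<Longrightarrow> norm (f z) \<le> B"
    and far: "\<And>z. z \<in> closure U \<Longrightarrow> R0 \<le> norm z \<Longrightarrow> norm (f z) \<le> B"
    and z: "z \<in> U"
  shows "norm (f z) \<le> B"
proof -
  define R where "R = max R0 (norm z) + 1"
  define S where "S = U \<inter> ball 0 R"
  have oS: "open S" unfolding S_def using U by auto
  have clS: "closure S \<subseteq> closure U \<inter> cball 0 R"
    by (rule closure_minimal) (use closure_subset[of U] in \<open>auto simp: S_def\<close>)
  show ?thesis
  proof (rule maximum_modulus_frontier[of f S])
    show "f holomorphic_on interior S" using hol oS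
      by (metis S_def holomorphic_on_subset inf_le1 interior_open)
    show "continuous_on (closure S) f" using cont clS by (meson continuous_on_subset le_inf_iff)
    show "bounded S" unfolding S_def by (simp add: bounded_Int)
    show "z \<in> S" using z by (auto simp: S_def R_def)
    fix p assume "p \<in> frontier S"
    hence p: "p \<in> closure U" "norm p \<le> R" "p \<notin> S"
      using clS oS by (auto simp: frontier_def interior_open)
    show "norm (f p) \<le> B"
    proof (cases "norm p < R")
      case True
      hence "p \<notin> U" using p by (auto simp: S_def)
      thus ?thesis using front p U by (simp add: frontier_def interior_open)
    next
      case False
      thus ?thesis using far p by (auto simp: R_def)
    qed
  qed
qed

text \<open>
  A point whose square lies in the sector of half-opening 45 degrees has argument at most
  22.5 degrees, so its cube stays strictly inside the right half-plane. This yields the decay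
  of the auxiliary factor in the quadrant.
\<close>

lemma Re_cube_lower_bound:
  fixes s :: complex
  assumes "0 < Re s" and "\<bar>Im (s\<^sup>2)\<bar> \<le> Re (s\<^sup>2)"
  shows "norm s ^ 3 * (2/27) \<le> Re (s ^ 3)"
proof -
  define a b where "a = Re s" and "b = \<bar>Im s\<bar>"
  have a: "a > 0" "b \<ge> 0" using assms by (auto simp: a_def b_def)
  have *: "2 * a * b \<le> a\<^sup>2 - b\<^sup>2"
    using assms by (simp add: a_def b_def power2_eq_square abs_mult mult_ac)
  have b: "b \<le> a / 2"
  proof (rule ccontr)
    assume "\<not> ?thesis"
    hence "b > a/2" by simp
    hence "2 * a * b > a * a" using a by simp
    thus False using * by (smt (verit) power2_eq_square zero_le_power2)
  qed
  have bb: "b\<^sup>2 \<le> a\<^sup>2/4" using power_mono[OF b a(2), of 2] by (simp add: power_divide)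
  have "Re (s^3) = a * (a\<^sup>2 - 3 * b\<^sup>2)"
    by (simp add: a_def b_def power3_eq_cube power2_eq_square algebra_simps)
  also have "\<dots> \<ge> a * (a\<^sup>2 / 4)" using bb a by (intro mult_left_mono) auto
  finally have 1: "Re (s^3) \<ge> a^3/4" by (simp add: power3_eq_cube power2_eq_square)
  have "norm s \<le> a + b" using cmod_le[of s] a by (simp add: a_def b_def)
  also have "\<dots> \<le> 3/2 * a" using b by simp
  finally have "norm s ^ 3 \<le> (3/2 * a)^3" by (intro power_mono) auto
  thus ?thesis using 1 by (simp add: power3_eq_cube)
qed

text \<open>
  A quadrant has opening 90 degrees, so growth of order 1 is subcritical: an auxiliary factor
  of order 3/2 makes the function tend to zero at infinity, and letting the weight \<open>\<delta>\<close> of that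
  factor tend to zero restores the original function.
\<close>

lemma phragmen_lindelof_quadrant:
  fixes f :: "complex \<Rightarrow> complex"
  assumes hol: "f holomorphic_on UNIV" and B: "0 < B"
    and growth: "\<And>z. norm (f z) \<le> A * exp (c * norm z)"
    and real_axis: "\<And>x. 0 \<le> x \<Longrightarrow> norm (f (of_real x)) \<le> B"
    and imag_axis: "\<And>y. 0 \<le> y \<Longrightarrow> norm (f (\<i> * of_real y)) \<le> B"
    and z: "0 \<le> Re z" "0 \<le> Im z"
  shows "norm (f z) \<le> B"
proof -
  define U where "U = {z. 0 < Re z} \<inter> {z. 0 < Im z}"
  define C where "C = {z. 0 \<le> Re z} \<inter> {z. 0 \<le> Im z}"
  \<comment> \<open>The map \<open>q\<close> turns the quadrant into a sector of half-opening 45 degrees about the positive axis; the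
      shift by 1 keeps the square root holomorphic at the corner.\<close>
  define q where "q z = (1 - \<i>) * z + 1" for z :: complex
  define s where "s z = csqrt (q z)" for z
  have A: "A \<ge> 0" using growth[of 0] by (smt (verit) exp_gt_zero norm_ge_zero zero_le_mult_iff)
  have U: "open U" unfolding U_def by (intro open_Int open_halfspace_Re_gt open_halfspace_Im_gt)
  have C: "closed C" unfolding C_def
    by (intro closed_Int closed_halfspace_Re_ge closed_halfspace_Im_ge)
  have clU: "closure U \<subseteq> C" by (rule closure_minimal[OF _ C]) (auto simp: U_def C_def)
  have q: "Re (q z) = 1 + Re z + Im z" "Im (q z) = Im z - Re z" for z
    by (auto simp: q_def algebra_simps)
  have qnr: "q z \<notin> \<real>\<^sub>\<le>\<^sub>0" if "z \<in> C" for z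
    using that q[of z] by (auto simp: complex_nonpos_Reals_iff C_def)
  have hols: "s holomorphic_on C"
    unfolding s_def using qnr by (auto intro!: holomorphic_intros simp: q_def)
  have s2: "(s z)\<^sup>2 = q z" for z by (simp add: s_def)
  have ns: "norm (s z) \<ge> sqrt (norm z)" "norm (s z) ^ 2 \<ge> norm z" if "z \<in> C" for z
  proof -
    have "norm z \<le> Re z + Im z" using cmod_le[of z] that by (auto simp: C_def)
    also have "\<dots> \<le> Re (q z)" by (simp add: q)
    also have "\<dots> \<le> norm (q z)" by (rule complex_Re_le_cmod)
    finally show "norm (s z) ^ 2 \<ge> norm z" by (metis norm_power s2)
    thus "norm (s z) \<ge> sqrt (norm z)" by (rule real_le_lsqrt[OF _ , rotated]) auto
  qed
  have Re3: "norm (s z) ^ 3 * (2/27) \<le> Re (s z ^ 3)" if "z \<in> C" for z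
  proof (rule Re_cube_lower_bound)
    show "0 < Re (s z)"
    proof (rule ccontr)
      assume "\<not> ?thesis"
      hence "Re (s z) = 0" using csqrt_principal[of "q z"] by (auto simp: s_def)
      hence "Re ((s z)\<^sup>2) \<le> 0" by (simp add: power2_eq_square)
      thus False using that q[of z] by (simp add: s2 C_def)
    qed
    show "\<bar>Im ((s z)\<^sup>2)\<bar> \<le> Re ((s z)\<^sup>2)" using that q[of z] by (auto simp: s2 C_def)
  qed
  have main: "norm (f w) \<le> B * exp (\<delta> * Re (s w ^ 3))" if \<delta>: "\<delta> > 0" and w: "w \<in> C" for \<delta> w
  proof -
    define g where "g z = f z * exp (- (of_real \<delta> * s z ^ 3))" for z
    have ng: "norm (g z) = norm (f z) * exp (- (\<delta> * Re (s z ^ 3)))" for z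
      by (simp add: g_def norm_mult)
    have gle: "norm (g z) \<le> norm (f z)" if "z \<in> C" for z
    proof -
      have "0 \<le> Re (s z ^ 3)" using Re3[OF that] by (smt (verit) norm_ge_zero zero_le_power mult_nonneg_nonneg divide_nonneg_nonneg)
      thus ?thesis unfolding ng using \<delta> by (simp add: mult_left_le)
    qed
    have axis: "norm (g z) \<le> B" if "z \<in> C" "Re z = 0 \<or> Im z = 0" for z
    proof -
      have "norm (f z) \<le> B"
      proof (cases "Im z = 0")
        case True
        hence "z = of_real (Re z)" by (simp add: complex_eq_iff)
        thus ?thesis using real_axis[of "Re z"] that by (auto simp: C_def)
      next
        case False
        hence "z = \<i> * of_real (Im z)" using that by (simp add: complex_eq_iff)
        thus ?thesis using imag_axis[of "Im z"] that by (auto simp: C_def)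
      qed
      thus ?thesis using gle[OF that(1)] by simp
    qed
    define R0 where "R0 = max (((\<bar>c\<bar> + 1) / (\<delta> * (2/27)))\<^sup>2) (A / B)"
    have far: "norm (g z) \<le> B" if zC: "z \<in> C" and zR: "R0 \<le> norm z" for z
    proof -
      have "(\<bar>c\<bar> + 1) / (\<delta> * (2/27)) \<le> sqrt (norm z)"
        by (rule real_le_rsqrt) (use zR in \<open>simp add: R0_def\<close>)
      also have "\<dots> \<le> norm (s z)" by (rule ns[OF zC])
      finally have 1: "\<bar>c\<bar> + 1 \<le> \<delta> * (2/27) * norm (s z)" using \<delta> by (simp add: field_simps)
      have "(\<bar>c\<bar> + 1) * norm z \<le> (\<delta> * (2/27) * norm (s z)) * norm (s z) ^ 2"
        using 1 ns(2)[OF zC] \<delta> by (intro mult_mono) auto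
      also have "\<dots> = \<delta> * (norm (s z) ^ 3 * (2/27))" by (simp add: power3_eq_cube power2_eq_square)
      also have "\<dots> \<le> \<delta> * Re (s z ^ 3)" using Re3[OF zC] \<delta> by (intro mult_left_mono) auto
      finally have 2: "(\<bar>c\<bar> + 1) * norm z \<le> \<delta> * Re (s z ^ 3)" .
      have 3: "c * norm z \<le> \<bar>c\<bar> * norm z" by (intro mult_right_mono) auto
      have "norm (g z) \<le> A * exp (c * norm z) * exp (- (\<delta> * Re (s z ^ 3)))"
        unfolding ng by (intro mult_right_mono growth) auto
      also have "\<dots> = A * exp (c * norm z - \<delta> * Re (s z ^ 3))" by (simp add: exp_diff exp_minus field_simps)
      also have "\<dots> \<le> A * exp (- norm z)"
        using 2 3 A by (intro mult_left_mono) (auto simp: algebra_simps)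
      also have "\<dots> \<le> B"
      proof -
        have "A / B \<le> exp (norm z)" using zR exp_ge_add_one_self[of "norm z"] unfolding R0_def by linarith
        thus ?thesis using B by (simp add: exp_minus field_simps)
      qed
      finally show ?thesis .
    qed
    have "norm (g w) \<le> B"
    proof (cases "w \<in> U")
      case True
      have holg: "g holomorphic_on C" unfolding g_def using hol hols
        by (intro holomorphic_intros) (auto intro: holomorphic_on_subset)
      show ?thesis
      proof (rule maximum_modulus_unbounded[OF U _ _ _ _ True])
        show "g holomorphic_on U" using holg by (rule holomorphic_on_subset) (auto simp: U_def C_def)
        show "continuous_on (closure U) g" using holg clU
          by (meson continuous_on_subset holomorphic_on_imp_continuous_on)
        show "norm (g p) \<le> B" if "p \<in> frontier U" for p
        proof -
          have "p \<in> C" "p \<notin> U" using that clU U by (auto simp: frontier_def interior_open)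
          thus ?thesis by (intro axis) (auto simp: U_def C_def)
        qed
        show "norm (g p) \<le> B" if "p \<in> closure U" "R0 \<le> norm p" for p
          using far clU that by blast
      qed
    next
      case False
      thus ?thesis using axis[OF w] w by (auto simp: U_def C_def)
    qed
    thus ?thesis unfolding ng by (simp add: exp_minus field_simps)
  qed
  have zC: "z \<in> C" using z by (simp add: C_def)
  have "((\<lambda>\<delta>. B * exp (\<delta> * Re (s z ^ 3))) \<longlongrightarrow> B * exp (0 * Re (s z ^ 3))) (at_right 0)"
    by (intro tendsto_intros)
  moreover have "\<forall>\<^sub>F \<delta> in at_right 0. norm (f z) \<le> B * exp (\<delta> * Re (s z ^ 3))"
    using main zC by (auto simp: eventually_at_right_less intro: eventually_at_rightI[of 0 1])
  ultimately show ?thesis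
    using tendsto_lowerbound trivial_limit_at_right_real by fastforce
qed

text \<open>
  The factor \<open>1 / (1 - \<i> \<delta> z)\<close> has modulus at most 1 in the upper half-plane and tends to zero at
  infinity. It replaces an a priori bound \<open>B\<close> by the supremum \<open>M\<close> over the real axis.
\<close>

lemma bounded_half_plane:
  fixes f :: "complex \<Rightarrow> complex"
  assumes hol: "f holomorphic_on UNIV" and M: "0 < M"
    and bounded: "\<And>z. 0 \<le> Im z \<Longrightarrow> norm (f z) \<le> B"
    and real_axis: "\<And>x. norm (f (of_real x)) \<le> M"
    and z: "0 \<le> Im z"
  shows "norm (f z) \<le> M"
proof -
  define U where "U = {z. 0 < Im z}"
  have U: "open U" unfolding U_def by (rule open_halfspace_Im_gt)
  have clU: "closure U \<subseteq> {z. 0 \<le> Im z}"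
    by (rule closure_minimal) (auto simp: U_def closed_halfspace_Im_ge)
  have main: "norm (f z) \<le> M * norm (1 - \<i> * of_real \<delta> * z)" if \<delta>: "\<delta> > 0" for \<delta>
  proof -
    define g where "g w = f w / (1 - \<i> * of_real \<delta> * w)" for w
    have n1: "1 \<le> norm (1 - \<i> * of_real \<delta> * w)" if "0 \<le> Im w" for w
    proof -
      have "1 \<le> Re (1 - \<i> * of_real \<delta> * w)" using that \<delta> by simp
      thus ?thesis using complex_Re_le_cmod order_trans by blast
    qed
    have holg: "g holomorphic_on {w. 0 \<le> Im w}"
      unfolding g_def using hol n1 
      by (intro holomorphic_intros) (auto intro: holomorphic_on_subset, fastforce)
    have gle: "norm (g w) \<le> norm (f w)" if "0 \<le> Im w" for w
      unfolding g_def norm_divide using n1[OF that] by (simp add: divide_le_eq mult_left_le mult_le_cancel_left1 )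
    have axis: "norm (g w) \<le> M" if "Im w = 0" for w
      using gle[of w] real_axis[of "Re w"] that by (simp add: complex_is_Real_iff)
    have "norm (g z) \<le> M"
    proof (cases "z \<in> U")
      case True
      show ?thesis
      proof (rule maximum_modulus_unbounded[OF U _ _ _ _ True])
        show "g holomorphic_on U" using holg by (rule holomorphic_on_subset) (auto simp: U_def)
        show "continuous_on (closure U) g" using holg clU
          by (meson continuous_on_subset holomorphic_on_imp_continuous_on)
        show "norm (g p) \<le> M" if "p \<in> frontier U" for p
        proof -
          have "0 \<le> Im p" "p \<notin> U" using that clU U by (auto simp: frontier_def interior_open)
          thus ?thesis by (intro axis) (auto simp: U_def)
        qed
        show "norm (g p) \<le> M" if "p \<in> closure U" and R: "(B / M + 1) / \<delta> \<le> norm p" for p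
        proof -
          have ip: "0 \<le> Im p" using that clU by auto
          have "B / M \<le> \<delta> * norm p - 1" using R \<delta> by (simp add: field_simps)
          also have "\<delta> * norm p = norm (\<i> * of_real \<delta> * p)" using \<delta> by (simp add: norm_mult)
          also have "\<dots> - 1 \<le> norm (1 - \<i> * of_real \<delta> * p)"
            by (smt (verit) norm_minus_commute norm_one norm_triangle_ineq2)
          finally have "B \<le> M * norm (1 - \<i> * of_real \<delta> * p)" using M by (simp add: field_simps)
          thus ?thesis using bounded[OF ip] n1[OF ip] M unfolding g_def norm_divide
            by (simp add: divide_le_eq)
        qed
      qed
    next
      case False
      thus ?thesis using axis z by (auto simp: U_def)
    qed
    thus ?thesis using n1[OF z] unfolding g_def norm_divide by (subst (asm) pos_divide_le_eq) linarith+
  qed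
  have "((\<lambda>\<delta>. M * norm (1 - \<i> * of_real \<delta> * z)) \<longlongrightarrow> M * norm (1 - \<i> * of_real 0 * z)) (at_right 0)"
    by (intro tendsto_intros)
  moreover have "\<forall>\<^sub>F \<delta> in at_right 0. norm (f z) \<le> M * norm (1 - \<i> * of_real \<delta> * z)"
    using main by (auto intro: eventually_at_rightI[of 0 1])
  ultimately show ?thesis
    using tendsto_lowerbound trivial_limit_at_right_real by fastforce
qed

text \<open>
  After multiplication by \<open>exp (\<i> c z)\<close> the function is bounded on the imaginary half-axis, so
  the quadrant theorem bounds it, by a constant depending on \<open>A\<close>, in both quadrants. The
  half-plane theorem then removes the dependence on \<open>A\<close>.
\<close>

lemma phragmen_lindelof_upper:
  fixes f :: "complex \<Rightarrow> complex"
  assumes hol: "f holomorphic_on UNIV" and M: "0 < M" and c: "0 \<le> c"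
    and growth: "\<And>z. norm (f z) \<le> A * exp (c * norm z)"
    and real_axis: "\<And>x. norm (f (of_real x)) \<le> M"
    and z: "0 \<le> Im z"
  shows "norm (f z) \<le> M * exp (c * Im z)"
proof -
  define u where "u z = f z * exp (\<i> * of_real c * z)" for z
  have holu: "u holomorphic_on UNIV" unfolding u_def by (intro holomorphic_intros hol)
  have nu: "norm (u z) = norm (f z) * exp (- (c * Im z))" for z
    by (simp add: u_def norm_mult)
  have A: "A \<ge> 0" using growth[of 0] by (smt (verit) exp_gt_zero norm_ge_zero zero_le_mult_iff)
  have gu: "norm (u z) \<le> A * exp ((2 * c) * norm z)" for z
  proof -
    have "norm (u z) \<le> A * exp (c * norm z) * exp (c * norm z)"
      unfolding nu using growth[of z] A c
    proof (intro mult_mono)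
      have "- Im z \<le> norm z" using abs_Im_le_cmod[of z] by linarith
      hence "c * (- Im z) \<le> c * norm z" using c by (rule mult_left_mono)
      thus "exp (- (c * Im z)) \<le> exp (c * norm z)" by simp
    qed auto
    also have "\<dots> = A * exp ((2 * c) * norm z)" by (simp add: mult_exp_exp)
    finally show ?thesis .
  qed
  define B where "B = max A M"
  have B: "0 < B" using M by (simp add: B_def)
  have ur: "norm (u (of_real x)) \<le> B" "norm (u (of_real x)) \<le> M" for x
    using real_axis[of x] by (auto simp: nu B_def)
  have ui: "norm (u (\<i> * of_real y)) \<le> B" if "y \<ge> 0" for y
  proof -
    have "norm (u (\<i> * of_real y)) \<le> A * exp (c * y) * exp (- (c * y))"
      unfolding nu using growth[of "\<i> * of_real y"] that by (simp add: norm_mult)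
    also have "\<dots> = A" by (simp add: mult_exp_exp mult.assoc)
    finally show ?thesis by (simp add: B_def)
  qed
  have "norm (u z) \<le> M"
  proof (rule bounded_half_plane[OF holu M _ ur(2) z])
    fix w :: complex assume w: "0 \<le> Im w"
    show "norm (u w) \<le> B"
    proof (cases "0 \<le> Re w")
      case True
      show ?thesis using phragmen_lindelof_quadrant[OF holu B gu ur(1) ui True w] by simp
    next
      case False
      \<comment> \<open>The first quadrant is rotated onto the second one.\<close>
      define v where "v z = u (\<i> * z)" for z
      have "norm (v (- \<i> * w)) \<le> B"
      proof (rule phragmen_lindelof_quadrant[OF _ B, of v A "2 * c"])
        show "v holomorphic_on UNIV" unfolding v_def
          by (rule holomorphic_on_compose_gen[OF _ holu, unfolded o_def]) (auto intro!: holomorphic_intros)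
        show "norm (v z) \<le> A * exp (2 * c * norm z)" for z using gu[of "\<i> * z"] by (simp add: v_def norm_mult)
        show "norm (v (of_real x)) \<le> B" if "x \<ge> 0" for x using ui that by (simp add: v_def)
        show "norm (v (\<i> * of_real y)) \<le> B" for y using ur(1)[of "-y"] by (simp add: v_def mult.assoc[symmetric])
      qed (use w False in auto)
      thus ?thesis by (simp add: v_def mult.assoc[symmetric])
    qed
  qed
  thus ?thesis unfolding nu by (simp add: exp_minus field_simps)
qed

text \<open>
  The point is that the bound does not involve \<open>A\<close>: it is uniform over any family of
  functions of exponential type with a common bound on the real axis.
\<close>

lemma phragmen_lindelof_exp_type:
  fixes f :: "complex \<Rightarrow> complex"
  assumes hol: "f holomorphic_on UNIV" and M: "0 < M" and c: "0 \<le> c"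
    and growth: "\<And>z. norm (f z) \<le> A * exp (c * norm z)"
    and real_axis: "\<And>x. norm (f (of_real x)) \<le> M"
  shows "norm (f z) \<le> M * exp (c * \<bar>Im z\<bar>)"
proof (cases "0 \<le> Im z")
  case True
  thus ?thesis using phragmen_lindelof_upper[OF hol M c growth real_axis] by simp
next
  case False
  have "norm (f (- (- z))) \<le> M * exp (c * Im (- z))"
  proof (rule phragmen_lindelof_upper[OF _ M c, where f = "\<lambda>z. f (- z)"])
    show "(\<lambda>z. f (- z)) holomorphic_on UNIV"
      by (rule holomorphic_on_compose_gen[OF _ hol, unfolded o_def]) (auto intro!: holomorphic_intros)
    show "norm (f (- w)) \<le> A * exp (c * norm w)" for w using growth[of "-w"] by simp
    show "norm (f (- of_real x)) \<le> M" for x using real_axis[of "-x"] by simp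
  qed (use False in auto)
  thus ?thesis using False by simp
qed

section \<open>A Bernstein inequality in the space of integrable functions\<close>

lemma entire_deriv_bound:
  fixes f :: "complex \<Rightarrow> complex"
  assumes "f holomorphic_on UNIV" and "\<And>w. norm (w - z) = 1 \<Longrightarrow> norm (f w) \<le> B"
  shows "norm (deriv f z) \<le> B"
proof -
  have "norm ((deriv ^^ 1) f z) \<le> fact 1 * B / 1 ^ 1"
  proof (rule Cauchy_inequality)
    show "f holomorphic_on ball z 1" "continuous_on (cball z 1) f"
      using assms holomorphic_on_imp_continuous_on by (auto intro: holomorphic_on_subset continuous_on_subset)
  qed (use assms(2) in \<open>auto simp: norm_minus_commute\<close>)
  thus ?thesis by simp
qed

text \<open>
  The average \<open>H z = integral of \<epsilon> t * f (z + t)\<close> over \<open>{-T..T}\<close> is entire of exponential type and is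
  bounded on the real axis by the \<open>L\<^sup>1\<close> norm of \<open>f\<close>, independently of \<open>T\<close> and \<open>\<epsilon>\<close>. Hence so is its
  derivative at the origin, which is the pairing of \<open>\<epsilon>\<close> with the derivative of \<open>f\<close>.
\<close>

lemma derivative_pairing_bound:
  fixes f :: "complex \<Rightarrow> complex" and \<epsilon> :: "real \<Rightarrow> complex"
  assumes hol: "f holomorphic_on UNIV" and c: "0 \<le> c"
    and growth: "\<And>z. norm (f z) \<le> A * exp (c * norm z)"
    and int: "integrable lborel (\<lambda>x. f (of_real x))"
    and M: "(LINT x|lborel. norm (f (of_real x))) \<le> M" "0 < M"
    and \<epsilon>: "continuous_on UNIV \<epsilon>" "\<And>t. norm (\<epsilon> t) \<le> 1" and T: "0 \<le> T"
  shows "norm (integral {-T..T} (\<lambda>t. \<epsilon> t * deriv f (of_real t))) \<le> M * exp c"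
proof -
  define H where "H z = integral {-T..T} (\<lambda>t. \<epsilon> t * f (z + of_real t))" for z
  have contf: "continuous_on UNIV f" and contf': "continuous_on UNIV (deriv f)"
    using hol by (auto intro!: holomorphic_on_imp_continuous_on holomorphic_deriv)
  have A: "A \<ge> 0" using growth[of 0] by (smt (verit) exp_gt_zero norm_ge_zero zero_le_mult_iff)
  have ci: "continuous_on S (\<lambda>t. \<epsilon> t * f (z + of_real t))" for z S
    by (intro continuous_intros continuous_on_compose2[OF contf] continuous_on_subset[OF \<epsilon>(1)]) auto
  have derH: "(H has_field_derivative integral {-T..T} (\<lambda>t. \<epsilon> t * deriv f (z + of_real t))) (at z)" for z
  proof -
    have "((\<lambda>z. integral (cbox (-T) T) (\<lambda>t. \<epsilon> t * f (z + of_real t)))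
        has_field_derivative integral (cbox (-T) T) (\<lambda>t. \<epsilon> t * deriv f (z + of_real t))) (at z within UNIV)"
    proof (rule leibniz_rule_field_derivative)
      fix w t
      have "(f has_field_derivative deriv f (w + of_real t)) (at (w + of_real t))"
        using hol by (simp add: holomorphic_derivI)
      hence "((\<lambda>x. f (x + of_real t)) has_field_derivative deriv f (w + of_real t)) (at w)"
        by (simp add: DERIV_shift add.commute)
      thus "((\<lambda>x. \<epsilon> t * f (x + of_real t)) has_field_derivative \<epsilon> t * deriv f (w + of_real t)) (at w within UNIV)"
        by (rule DERIV_cmult)
    next
      show "(\<lambda>t. \<epsilon> t * f (w + of_real t)) integrable_on cbox (-T) T" for w
        by (intro integrable_continuous ci)
    next
      show "continuous_on (UNIV \<times> cbox (-T) T) (\<lambda>(w, t). \<epsilon> t * deriv f (w + of_real t))"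
        unfolding split_beta
        by (intro continuous_intros continuous_on_compose2[OF contf'] continuous_on_compose2[OF \<epsilon>(1)]) auto
    qed auto
    thus ?thesis by (simp add: H_def[abs_def])
  qed
  have holH: "H holomorphic_on UNIV"
    using derH by (meson field_differentiable_def field_differentiable_at_within holomorphic_on_def)
  have growthH: "norm (H z) \<le> (2 * T * A * exp (c * T)) * exp (c * norm z)" for z
  proof -
    have "norm (H z) \<le> integral {-T..T} (\<lambda>t. A * exp (c * T) * exp (c * norm z))"
      unfolding H_def
    proof (rule integral_norm_bound_integral)
      show "(\<lambda>t. \<epsilon> t * f (z + of_real t)) integrable_on {-T..T}"
        by (intro integrable_continuous_interval ci)
      fix t assume t: "t \<in> {-T..T}"
      have "norm (z + of_real t) \<le> norm z + T"
        using t by (intro order_trans[OF norm_triangle_ineq]) auto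
      hence "c * norm (z + of_real t) \<le> c * (norm z + T)" using c by (intro mult_left_mono)
      hence "exp (c * norm (z + of_real t)) \<le> exp (c * T) * exp (c * norm z)"
        by (simp add: mult_exp_exp algebra_simps)
      hence "norm (f (z + of_real t)) \<le> A * (exp (c * T) * exp (c * norm z))"
        using growth[of "z + of_real t"] A by (meson mult_left_mono order_trans)
      thus "norm (\<epsilon> t * f (z + of_real t)) \<le> A * exp (c * T) * exp (c * norm z)"
        unfolding norm_mult using mult_mono[OF \<epsilon>(2)[of t]] by fastforce
    qed auto
    also have "\<dots> = (2 * T * A * exp (c * T)) * exp (c * norm z)" using T by simp
    finally show ?thesis .
  qed
  have realH: "norm (H (of_real x)) \<le> M" for x
  proof -
    have int': "integrable lborel (\<lambda>t. norm (f (of_real (x + t))))"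
      using lborel_integrable_real_affine[OF integrable_norm[OF int], of 1 x] by simp
    have s: "set_integrable lborel {-T..T} (\<lambda>t. norm (f (of_real (x + t))))"
      unfolding set_integrable_def by (rule integrable_mult_indicator[OF _ int']) simp
    have "norm (H (of_real x)) \<le> integral {-T..T} (\<lambda>t. norm (f (of_real (x + t))))"
      unfolding H_def
    proof (rule integral_norm_bound_integral)
      show "(\<lambda>t. \<epsilon> t * f (of_real x + of_real t)) integrable_on {-T..T}"
        by (intro integrable_continuous_interval ci)
      show "(\<lambda>t. norm (f (of_real (x + t)))) integrable_on {-T..T}"
        by (rule set_borel_integral_eq_integral[OF s])
      show "norm (\<epsilon> t * f (of_real x + of_real t)) \<le> norm (f (of_real (x + t)))" for t
        unfolding norm_mult using mult_right_mono[OF \<epsilon>(2)[of t]] by fastforce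
    qed
    also have "\<dots> = (LINT t:{-T..T}|lborel. norm (f (of_real (x + t))))"
      by (rule set_borel_integral_eq_integral(2)[OF s, symmetric])
    also have "\<dots> \<le> (LINT t|lborel. norm (f (of_real (x + t))))"
      unfolding set_lebesgue_integral_def using s int' unfolding set_integrable_def
      by (intro integral_mono) (auto simp: indicator_def)
    also have "\<dots> = (LINT t|lborel. norm (f (of_real t)))"
      using lborel_integral_real_affine[of 1 "\<lambda>t. norm (f (of_real t))" x] by simp
    finally show ?thesis using M by simp
  qed
  have "norm (deriv H 0) \<le> M * exp c"
  proof (rule entire_deriv_bound[OF holH])
    fix z :: complex assume "norm (z - 0) = 1"
    hence "\<bar>Im z\<bar> \<le> 1" using abs_Im_le_cmod[of z] by simp
    hence "c * \<bar>Im z\<bar> \<le> c" using c by (simp add: mult_left_le)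
    moreover have "norm (H z) \<le> M * exp (c * \<bar>Im z\<bar>)"
      by (rule phragmen_lindelof_exp_type[OF holH M(2) c growthH realH])
    ultimately show "norm (H z) \<le> M * exp c" using M(2)
      by (smt (verit) exp_le_cancel_iff mult_left_mono)
  qed
  moreover have "deriv H 0 = integral {-T..T} (\<lambda>t. \<epsilon> t * deriv f (of_real t))"
    using DERIV_imp_deriv[OF derH[of 0]] by simp
  ultimately show ?thesis by simp
qed

lemma integrable_if_bounded_integrals:
  fixes g :: "real \<Rightarrow> complex"
  assumes cont: "continuous_on UNIV g"
    and bound: "\<And>T. 0 \<le> T \<Longrightarrow> integral {-T..T} (\<lambda>t. norm (g t)) \<le> B"
  shows "integrable lborel g"
proof (rule integrableI_bounded)
  show [measurable]: "g \<in> borel_measurable lborel"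
    using borel_measurable_continuous_onI[OF cont] by simp
  have "(\<integral>\<^sup>+x. ennreal (norm (g x)) \<partial>lborel) =
      (\<integral>\<^sup>+x. (SUP n. ennreal (norm (g x)) * indicator {- real n..real n} x) \<partial>lborel)"
  proof (intro nn_integral_cong)
    fix x :: real
    obtain n where n: "\<bar>x\<bar> \<le> real n" using real_arch_simple by blast
    show "ennreal (norm (g x)) = (SUP n. ennreal (norm (g x)) * indicator {- real n..real n} x)"
    proof (rule antisym)
      have "ennreal (norm (g x)) = ennreal (norm (g x)) * indicator {- real n..real n} x"
        using n by (auto simp: indicator_def)
      thus "ennreal (norm (g x)) \<le> (SUP n. ennreal (norm (g x)) * indicator {- real n..real n} x)"
        by (intro SUP_upper2[of n]) auto
      show "(SUP n. ennreal (norm (g x)) * indicator {- real n..real n} x) \<le> ennreal (norm (g x))"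
        by (intro SUP_least) (auto simp: indicator_def)
    qed
  qed
  also have "\<dots> = (SUP n. \<integral>\<^sup>+x. ennreal (norm (g x)) * indicator {- real n..real n} x \<partial>lborel)"
  proof (rule nn_integral_monotone_convergence_SUP)
    show "incseq (\<lambda>n x. ennreal (norm (g x)) * indicator {- real n..real n} x)"
      by (auto simp: incseq_def le_fun_def indicator_def)
  qed simp
  also have "\<dots> \<le> ennreal B"
  proof (rule SUP_least)
    fix n :: nat
    have s: "set_integrable lborel {- real n..real n} (\<lambda>t. norm (g t))"
      unfolding set_integrable_def
      by (intro borel_integrable_compact continuous_intros continuous_on_subset[OF cont]) auto
    have "(\<integral>\<^sup>+x. ennreal (norm (g x)) * indicator {- real n..real n} x \<partial>lborel) =
       (\<integral>\<^sup>+x. ennreal (indicator {- real n..real n} x *\<^sub>R norm (g x)) \<partial>lborel)"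
      by (intro nn_integral_cong) (auto simp: indicator_def)
    also have "\<dots> = ennreal (LINT x:{- real n..real n}|lborel. norm (g x))"
      using s unfolding set_lebesgue_integral_def set_integrable_def
      by (intro nn_integral_eq_integral) auto
    also have "(LINT x:{- real n..real n}|lborel. norm (g x)) = integral {- real n..real n} (\<lambda>t. norm (g t))"
      by (rule set_borel_integral_eq_integral(2)[OF s])
    also have "ennreal \<dots> \<le> ennreal B" using bound[of "real n"] by (intro ennreal_leI) auto
    finally show "(\<integral>\<^sup>+x. ennreal (norm (g x)) * indicator {- real n..real n} x \<partial>lborel) \<le> ennreal B" .
  qed
  finally show "(\<integral>\<^sup>+x. ennreal (norm (g x)) \<partial>lborel) < \<infinity>"
    by (metis ennreal_less_top infinity_ennreal_def le_less_trans)
qed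

text \<open>
  Qualitative Bernstein inequality in \<open>L\<^sup>1\<close>. The pairing bound is tested with a continuous
  approximation of the conjugate phase of the derivative, on all intervals at once.
\<close>

lemma integrable_deriv_exp_type:
  fixes f :: "complex \<Rightarrow> complex"
  assumes hol: "f holomorphic_on UNIV" and c: "0 \<le> c"
    and growth: "\<And>z. norm (f z) \<le> A * exp (c * norm z)"
    and int: "integrable lborel (\<lambda>x. f (of_real x))"
  shows "integrable lborel (\<lambda>x. deriv f (of_real x))"
proof -
  define M where "M = (LINT x|lborel. norm (f (of_real x))) + 1"
  have M: "(LINT x|lborel. norm (f (of_real x))) \<le> M" "0 < M"
    by (auto simp: M_def add_nonneg_pos)
  define g where "g t = deriv f (of_real t)" for t
  have "continuous_on UNIV (deriv f)"
    using hol by (intro holomorphic_on_imp_continuous_on holomorphic_deriv) auto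
  hence contg: "continuous_on UNIV g" unfolding g_def
    by (rule continuous_on_compose2) (auto intro!: continuous_intros)
  have "integral {-T..T} (\<lambda>t. norm (g t)) \<le> M * exp c" if T: "0 \<le> T" for T
  proof -
    have *: "integral {-T..T} (\<lambda>t. norm (g t)) \<le> M * exp c + 2 * T * \<eta>" if \<eta>: "\<eta> > 0" for \<eta>
    proof -
      \<comment> \<open>The summand \<open>\<eta>\<close> makes the phase continuous at the zeros of \<open>g\<close>.\<close>
      define \<epsilon> where "\<epsilon> t = cnj (g t) / of_real (norm (g t) + \<eta>)" for t
      have pos: "norm (g t) + \<eta> > 0" for t using \<eta> by (simp add: add_nonneg_pos)
      have cont\<epsilon>: "continuous_on UNIV \<epsilon>"
        unfolding \<epsilon>_def using pos
        by (intro continuous_intros contg ballI) (metis less_irrefl of_real_eq_0_iff)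
      have \<epsilon>1: "norm (\<epsilon> t) \<le> 1" for t
        using pos[of t] \<eta> by (simp add: \<epsilon>_def norm_divide del: of_real_add)
      have \<epsilon>g: "Re (\<epsilon> t * g t) \<ge> norm (g t) - \<eta>" for t
      proof -
        have "\<epsilon> t * g t = of_real ((norm (g t))\<^sup>2 / (norm (g t) + \<eta>))"
          unfolding \<epsilon>_def using complex_norm_square[of "g t"] by (simp add: mult.commute)
        hence "Re (\<epsilon> t * g t) = (norm (g t))\<^sup>2 / (norm (g t) + \<eta>)" by (simp only: Re_complex_of_real)
        also have "\<dots> \<ge> norm (g t) - \<eta>"
          by (subst pos_le_divide_eq[OF pos]) (simp add: algebra_simps power2_eq_square)
        finally show ?thesis .
      qed
      have i1: "(\<lambda>t. norm (g t)) integrable_on {-T..T}" "(\<lambda>t. \<epsilon> t * g t) integrable_on {-T..T}"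
        by (intro integrable_continuous_interval continuous_intros
            continuous_on_subset[OF contg] continuous_on_subset[OF cont\<epsilon>]; simp)+
      have "integral {-T..T} (\<lambda>t. norm (g t)) - 2 * T * \<eta> = integral {-T..T} (\<lambda>t. norm (g t) - \<eta>)"
        using i1 T by (subst integral_diff) auto
      also have "\<dots> \<le> integral {-T..T} (\<lambda>t. Re (\<epsilon> t * g t))"
        using i1 \<epsilon>g by (intro integral_le integrable_diff) (auto intro: integrable_linear[OF i1(2) bounded_linear_Re, unfolded o_def] simp del: times_complex.sel)
      also have "\<dots> = Re (integral {-T..T} (\<lambda>t. \<epsilon> t * g t))"
        using integral_linear[OF i1(2) bounded_linear_Re] by (simp add: o_def del: times_complex.sel)
      also have "\<dots> \<le> norm (integral {-T..T} (\<lambda>t. \<epsilon> t * g t))" by (rule complex_Re_le_cmod)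
      also have "\<dots> \<le> M * exp c" unfolding g_def
        by (rule derivative_pairing_bound[OF hol c growth int M cont\<epsilon> \<epsilon>1 T])
      finally show ?thesis by simp
    qed
    have "((\<lambda>\<eta>. M * exp c + 2 * T * \<eta>) \<longlongrightarrow> M * exp c + 2 * T * 0) (at_right 0)"
      by (intro tendsto_intros)
    moreover have "\<forall>\<^sub>F \<eta> in at_right 0. integral {-T..T} (\<lambda>t. norm (g t)) \<le> M * exp c + 2 * T * \<eta>"
      using * by (auto intro: eventually_at_rightI[of 0 1])
    ultimately show ?thesis
      using tendsto_lowerbound trivial_limit_at_right_real by fastforce
  qed
  hence "integrable lborel g" by (rule integrable_if_bounded_integrals[OF contg])
  thus ?thesis by (simp add: g_def[abs_def])
qed

section \<open>Hadamard products for functions of order 1/2\<close>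

lemma entire_divide_linear:
  fixes f :: "complex \<Rightarrow> complex"
  assumes "f holomorphic_on UNIV" "f a = 0"
  obtains g where "g holomorphic_on UNIV" "\<And>z. f z = (z - a) * g z"
proof
  show "(\<lambda>z. if z = a then deriv f a else (f z - f a) / (z - a)) holomorphic_on UNIV"
    by (rule pole_lemma) (use assms in auto)
  show "f z = (z - a) * (if z = a then deriv f a else (f z - f a) / (z - a))" for z
    using assms by auto
qed

text \<open>
  The zeros in \<open>S\<close> are distinct, so splitting off one of the factors does not disturb the
  vanishing of the quotient at the other points.
\<close>

lemma entire_divide_zeros:
  fixes f :: "complex \<Rightarrow> complex"
  assumes "finite S" "f holomorphic_on UNIV" "0 \<notin> S" "\<And>a. a \<in> S \<Longrightarrow> f a = 0"
  shows "\<exists>g. g holomorphic_on UNIV \<and> (\<forall>z. f z = (\<Prod>a\<in>S. 1 - z / a) * g z)"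
  using assms
proof (induction S rule: finite_induct)
  case empty
  thus ?case by auto
next
  case (insert a S)
  then obtain g where g: "g holomorphic_on UNIV" "\<And>z. f z = (\<Prod>a\<in>S. 1 - z / a) * g z"
    by auto
  have "(\<Prod>b\<in>S. 1 - a / b) \<noteq> 0" using insert by (auto simp: divide_eq_1_iff)
  hence "g a = 0" using g(2)[of a] insert by auto
  then obtain h where h: "h holomorphic_on UNIV" "\<And>z. g z = (z - a) * h z"
    using entire_divide_linear[OF g(1)] by blast
  show ?case
  proof (intro exI conjI allI)
    show "(\<lambda>z. - a * h z) holomorphic_on UNIV" using h by (intro holomorphic_intros)
    fix z
    have "(1 - z / a) * (- a * h z) = g z" using insert by (simp add: h field_simps)
    moreover have "(\<Prod>a\<in>insert a S. 1 - z / a) * (- a * h z) =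
        (\<Prod>a\<in>S. 1 - z / a) * ((1 - z / a) * (- a * h z))"
      using insert(1,2) by simp
    ultimately show "f z = (\<Prod>a\<in>insert a S. 1 - z / a) * (- a * h z)"
      using g(2)[of z] by simp
  qed
qed

text \<open>
  The map \<open>l / (2 M - l)\<close> sends the half-plane \<open>Re l < M\<close> to the unit disc and fixes 0, so the
  claim is the Schwarz lemma for its composition with \<open>L\<close>.
\<close>

lemma borel_caratheodory:
  fixes L :: "complex \<Rightarrow> complex"
  assumes hol: "L holomorphic_on ball 0 R" and L0: "L 0 = 0" and M: "0 < M"
    and Re: "\<And>z. z \<in> ball 0 R \<Longrightarrow> Re (L z) < M" and w: "norm w < R"
  shows "norm (L w) \<le> 2 * M * norm w / (R - norm w)"
proof -
  have R: "R > 0" using w by (smt (verit) norm_ge_zero)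
  have in_ball: "of_real R * z \<in> ball 0 R" if "norm z < 1" for z :: complex
    using that R by (simp add: norm_mult)
  have nz: "2 * of_real M - L z \<noteq> 0" if "z \<in> ball 0 R" for z
  proof
    assume "2 * of_real M - L z = 0"
    hence "Re (L z) = 2 * M" by (metis Re_complex_of_real eq_iff_diff_eq_0 of_real_mult of_real_numeral)
    thus False using Re[OF that] M by simp
  qed
  define s where "s z = L (of_real R * z) / (2 * of_real M - L (of_real R * z))" for z
  have hols: "s holomorphic_on ball 0 1"
  proof -
    have "(L \<circ> (\<lambda>z. of_real R * z)) holomorphic_on ball 0 1"
      by (rule holomorphic_on_compose_gen[OF _ hol]) (use in_ball in \<open>auto intro!: holomorphic_intros\<close>)
    thus ?thesis unfolding s_def o_def
      using nz in_ball by (intro holomorphic_intros) auto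
  qed
  have s1: "norm (s z) < 1" if z: "norm z < 1" for z
  proof -
    define l where "l = L (of_real R * z)"
    have l: "Re l < M" unfolding l_def by (rule Re[OF in_ball[OF z]])
    have "(norm l)\<^sup>2 < (norm (2 * of_real M - l))\<^sup>2"
      unfolding cmod_power2 using mult_strict_left_mono[OF l, of "4 * M"] M
      by (simp add: power2_eq_square algebra_simps)
    hence "norm l < norm (2 * of_real M - l)" by (rule power_less_imp_less_base) simp
    thus ?thesis by (simp add: s_def l_def[symmetric] norm_divide divide_less_eq)
  qed
  define z where "z = w / of_real R"
  have z: "norm z < 1" "of_real R * z = w" "norm z = norm w / R" using w R by (auto simp: z_def norm_divide)
  have sz: "norm (s z) \<le> norm z"
    by (rule Schwarz_Lemma(1)[OF hols _ s1 z(1)]) (auto simp: s_def L0)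
  define l where "l = L w"
  have "2 * of_real M - l \<noteq> 0" unfolding l_def by (rule nz) (use w in auto)
  hence "l * (1 + s z) = 2 * of_real M * s z"
    unfolding s_def z(2) l_def[symmetric] by (simp add: field_simps)
  hence "norm (l * (1 + s z)) = norm (2 * of_real M * s z)" by simp
  hence "norm l * norm (1 + s z) = 2 * M * norm (s z)" using M
    by (simp add: norm_mult)
  moreover have "norm l * (1 - norm z) \<le> norm l * norm (1 + s z)"
    using sz norm_triangle_ineq2[of 1 "- s z"] by (intro mult_left_mono) auto
  moreover have "2 * M * norm (s z) \<le> 2 * M * norm z" using sz M by simp
  ultimately have "norm l * (1 - norm w / R) \<le> 2 * M * (norm w / R)" using z(3) by simp
  hence "R * (norm l * (1 - norm w / R)) \<le> R * (2 * M * (norm w / R))"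
    using R by (intro mult_left_mono) auto
  hence "norm l * (R - norm w) \<le> 2 * M * norm w" using R by (simp add: right_diff_distrib mult_ac)
  thus ?thesis using w by (simp add: pos_le_divide_eq l_def)
qed

text \<open>
  Dividing out the zeros in a disc of radius \<open>R\<close> leaves a function without zeros there, whose
  logarithm has real part at most \<open>O(sqrt R)\<close>. By Borel-Caratheodory the logarithm at a fixed point is
  \<open>O(sqrt R / R)\<close>. No counting of zeros is involved.
\<close>

lemma hadamard_remainder:
  fixes f :: "complex \<Rightarrow> complex"
  assumes hol: "f holomorphic_on UNIV" and f0: "f 0 = 1" and c: "0 \<le> c"
    and growth: "\<And>z. norm (f z) \<le> A * exp (c * sqrt (norm z))"
    and S: "finite S" "S = {z \<in> ball 0 R. f z = 0}"
    and simple: "\<And>z. f z = 0 \<Longrightarrow> deriv f z \<noteq> 0"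
    and w: "norm w < R"
  shows "\<exists>l. f w = (\<Prod>a\<in>S. 1 - w / a) * exp l \<and>
    norm l \<le> 2 * (\<bar>ln A\<bar> + c * sqrt (3 * R) + 1) * norm w / (R - norm w)"
proof -
  have R: "R > 0" using w by (smt (verit) norm_ge_zero)
  have A: "A \<ge> 1" using growth[of 0] f0 by simp
  have S0: "0 \<notin> S" using f0 S by auto
  obtain g where g: "g holomorphic_on UNIV" "\<And>z. f z = (\<Prod>a\<in>S. 1 - z / a) * g z"
    using entire_divide_zeros[OF S(1) hol S0] S(2) by auto
  define P where "P z = (\<Prod>a\<in>S. 1 - z / a)" for z
  have holP: "P holomorphic_on UNIV" unfolding P_def using S0 by (intro holomorphic_intros) auto
  have g0: "g 0 = 1" using g(2)[of 0] f0 by simp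
  have gnz: "g z \<noteq> 0" if z: "z \<in> ball 0 R" for z
  proof
    \<comment> \<open>A zero of \<open>g\<close> in the disc would be a double zero of \<open>f\<close>.\<close>
    assume gz: "g z = 0"
    hence fz: "f z = 0" using g(2) by simp
    hence zS: "z \<in> S" using S z by auto
    hence Pz: "P z = 0" unfolding P_def using S(1) S0 by (intro prod_zero) (auto intro!: bexI[of _ z])
    have "((\<lambda>z. P z * g z) has_field_derivative P z * deriv g z + deriv P z * g z) (at z)"
      using holP g(1) by (intro DERIV_mult' holomorphic_derivI[of _ UNIV]) auto
    moreover have "(\<lambda>z. P z * g z) = f" using g(2) by (auto simp: P_def)
    ultimately have "deriv f z = 0" using DERIV_imp_deriv gz Pz by fastforce
    thus False using simple[OF fz] by simp
  qed
  \<comment> \<open>On the circle of radius \<open>3 * R\<close> every factor \<open>1 - p / a\<close> has modulus at least 2.\<close>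
  have bound: "norm (g z) \<le> A * exp (c * sqrt (3 * R))" if z: "z \<in> ball 0 R" for z
  proof (rule maximum_modulus_frontier[of g "ball 0 (3 * R)"])
    fix p :: complex assume "p \<in> frontier (ball 0 (3 * R))"
    hence p: "norm p = 3 * R" using R by simp
    have "1 \<le> (\<Prod>a\<in>S. norm (1 - p / a))"
    proof (rule prod_ge_1)
      fix a assume a: "a \<in> S"
      hence "norm a < R" "a \<noteq> 0" using S S0 by auto
      hence "norm (p / a) \<ge> 3" by (simp add: norm_divide p pos_le_divide_eq)
      thus "1 \<le> norm (1 - p / a)" using norm_triangle_ineq2[of "p / a" 1] by (simp add: norm_minus_commute)
    qed
    hence "norm (g p) \<le> norm (f p)"
      by (simp add: g(2)[of p] norm_mult prod_norm mult_le_cancel_right1)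
    thus "norm (g p) \<le> A * exp (c * sqrt (3 * R))" using growth[of p] p by simp
  qed (use g(1) z R in \<open>auto intro: holomorphic_on_subset continuous_on_subset holomorphic_on_imp_continuous_on\<close>)
  obtain L0 where L0: "L0 holomorphic_on ball 0 R" "\<And>z. z \<in> ball 0 R \<Longrightarrow> g z = exp (L0 z)"
  proof (rule contractible_imp_holomorphic_log[of g "ball 0 R"])
    show "g holomorphic_on ball 0 R" using g(1) by (rule holomorphic_on_subset) simp
  qed (use gnz in \<open>auto intro: convex_imp_contractible\<close>)
  define L where "L z = L0 z - L0 0" for z
  have L: "g z = exp (L z)" if "z \<in> ball 0 R" for z
    using L0(2)[OF that] L0(2)[of 0] R g0 by (simp add: L_def exp_diff)
  have "norm (L w) \<le> 2 * (\<bar>ln A\<bar> + c * sqrt (3 * R) + 1) * norm w / (R - norm w)"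
  proof (rule borel_caratheodory[OF _ _ _ _ w])
    show "L holomorphic_on ball 0 R" unfolding L_def by (intro holomorphic_intros L0)
    show "L 0 = 0" by (simp add: L_def)
    show "0 < \<bar>ln A\<bar> + c * sqrt (3 * R) + 1" using c R by (intro add_nonneg_pos add_nonneg_nonneg) auto
    show "Re (L z) < \<bar>ln A\<bar> + c * sqrt (3 * R) + 1" if z: "z \<in> ball 0 R" for z
    proof -
      have "exp (Re (L z)) \<le> exp (ln A + c * sqrt (3 * R))"
        using bound[OF z] L[OF z] A by (simp add: exp_add)
      thus ?thesis by simp
    qed
  qed
  thus ?thesis using g(2)[of w] L[of w] w by (intro exI[of _ "L w"]) auto
qed

text \<open>
  Hadamard factorisation of genus 0, in the form of a limit of the finite products over the
  zeros in growing discs: growth of order 1/2 makes the remainder tend to 1.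
\<close>

lemma hadamard_product_simple_zeros:
  fixes f :: "complex \<Rightarrow> complex"
  assumes hol: "f holomorphic_on UNIV" and f0: "f 0 = 1" and c: "0 \<le> c"
    and growth: "\<And>z. norm (f z) \<le> A * exp (c * sqrt (norm z))"
    and S: "\<And>n. finite (S n)" "\<And>n. S n = {z \<in> ball 0 (R n). f z = 0}"
    and simple: "\<And>z. f z = 0 \<Longrightarrow> deriv f z \<noteq> 0"
    and R: "filterlim R at_top sequentially"
  shows "(\<lambda>n. \<Prod>a\<in>S n. 1 - w / a) \<longlonglongrightarrow> f w"
proof -
  define E where "E r = 2 * (\<bar>ln A\<bar> + c * sqrt (3 * r) + 1) * norm w / (r - norm w)" for r
  have "\<exists>l. norm w < R n \<longrightarrow> f w = (\<Prod>a\<in>S n. 1 - w / a) * exp l \<and> norm l \<le> E (R n)" for n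
    using hadamard_remainder[OF hol f0 c growth S simple, of w n] unfolding E_def by blast
  then obtain l where l: "\<And>n. norm w < R n \<Longrightarrow> f w = (\<Prod>a\<in>S n. 1 - w / a) * exp (l n)"
    "\<And>n. norm w < R n \<Longrightarrow> norm (l n) \<le> E (R n)" by metis
  have ev: "\<forall>\<^sub>F n in sequentially. norm w < R n"
    using R by (auto simp: filterlim_at_top_dense)
  have "(E \<longlongrightarrow> 0) at_top"
  proof -
    have "((\<lambda>r. 2 * (\<bar>ln A\<bar> + c * sqrt (3 * r) + 1) / (r - norm w)) \<longlongrightarrow> 0) at_top"
    proof -
      have "((\<lambda>r. 2 * (\<bar>ln A\<bar> + 1) * (1 / (r - norm w)) + 2 * c * (sqrt (3 * r) / (r - norm w))) \<longlongrightarrow>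
          2 * (\<bar>ln A\<bar> + 1) * 0 + 2 * c * 0) at_top"
        by (intro tendsto_intros; real_asymp)
      thus ?thesis by (simp add: add_divide_distrib distrib_left mult_ac add_ac)
    qed
    from tendsto_mult_right_zero[OF this, of "norm w"] show ?thesis
      unfolding E_def[abs_def] by (simp add: mult.commute)
  qed
  hence E: "(\<lambda>n. E (R n)) \<longlonglongrightarrow> 0" using R by (rule filterlim_compose)
  have "l \<longlonglongrightarrow> 0"
    by (rule Lim_null_comparison[OF _ E]) (use ev in eventually_elim, use l in auto)
  hence "(\<lambda>n. f w * exp (- l n)) \<longlonglongrightarrow> f w * exp (- 0)"
    by (intro tendsto_intros)
  moreover have "\<forall>\<^sub>F n in sequentially. f w * exp (- l n) = (\<Prod>a\<in>S n. 1 - w / a)"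
    using ev
  proof eventually_elim
    case (elim n)
    thus ?case using l(1)[OF elim] by (simp add: exp_minus)
  qed
  ultimately show ?thesis using tendsto_cong by fastforce
qed

section \<open>Radial integrals and minima of the integral norm\<close>

text \<open>
  Polar integration for radial functions: both measures give \<open>{..a}\<close> the volume of the ball of
  radius \<open>a\<close>, and these half-lines generate the Borel sets.
\<close>

lemma distr_norm_lborel:
  "distr lborel borel (norm :: 'a::euclidean_space \<Rightarrow> real) =
   density lborel (\<lambda>r. ennreal (indicator {0..} r *
     (DIM('a) * measure lborel (ball (0::'a) 1) * r ^ (DIM('a) - 1))))"
  (is "?M = density lborel (\<lambda>r. ennreal (?w r))")
proof (rule measure_eqI_generator_eq_countable)
  define V where "V = unit_ball_vol (real DIM('a))"
  have V: "measure lborel (ball (0::'a) 1) = V" by (simp add: V_def content_ball)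
  have V0: "V > 0" by (simp add: V_def)
  let ?E = "range (\<lambda>a::real. {..a})"
  show "Int_stable ?E" by (auto simp: Int_stable_def)
  show "?E \<subseteq> Pow UNIV" by simp
  show "sets ?M = sigma_sets UNIV ?E" "sets (density lborel (\<lambda>r. ennreal (?w r))) = sigma_sets UNIV ?E"
    by (simp_all add: borel_eq_atMost)
  have emb: "emeasure ?M {..a} = ennreal (if a < 0 then 0 else V * a ^ DIM('a))" for a
  proof -
    have "emeasure ?M {..a} = emeasure lborel (norm -` {..a} :: 'a set)"
      by (subst emeasure_distr) auto
    also have "norm -` {..a} = cball (0::'a) a" by auto
    finally show ?thesis by (simp add: emeasure_cball V_def)
  qed
  have emd: "emeasure (density lborel (\<lambda>r. ennreal (?w r))) {..a} =
      ennreal (if a < 0 then 0 else V * a ^ DIM('a))" for a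
  proof -
    have "emeasure (density lborel (\<lambda>r. ennreal (?w r))) {..a} =
        (\<integral>\<^sup>+r. ennreal (?w r) * indicator {..a} r \<partial>lborel)"
      by (subst emeasure_density) auto
    also have "\<dots> = (\<integral>\<^sup>+r. ennreal (DIM('a) * V * r ^ (DIM('a) - 1)) * indicator {0..a} r \<partial>lborel)"
      by (intro nn_integral_cong) (auto simp: indicator_def V)
    also have "\<dots> = ennreal (if a < 0 then 0 else V * a ^ DIM('a))"
    proof (cases "a < 0")
      case False
      have "(\<integral>\<^sup>+r. ennreal (DIM('a) * V * r ^ (DIM('a) - 1)) * indicator {0..a} r \<partial>lborel) =
          ennreal (V * a ^ DIM('a) - V * 0 ^ DIM('a))"
        using False V0 by (intro nn_integral_FTC_Icc) (auto intro!: derivative_eq_intros)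
      thus ?thesis using False by (simp add: zero_power[OF DIM_positive])
    qed simp
    finally show ?thesis .
  qed
  show "emeasure ?M X = emeasure (density lborel (\<lambda>r. ennreal (?w r))) X" if "X \<in> ?E" for X
    using that emb emd by auto
  show "range (\<lambda>n. {..real n}) \<subseteq> ?E" by auto
  show "\<Union> (range (\<lambda>n. {..real n})) = UNIV" using real_arch_simple by auto
  show "countable (range (\<lambda>n. {..real n}))" by simp
  show "emeasure ?M a \<noteq> \<infinity>" if "a \<in> range (\<lambda>n. {..real n})" for a
    using that emb by auto
qed

lemma
  fixes u :: "real \<Rightarrow> 'b::{banach, second_countable_topology}"
  assumes [measurable]: "u \<in> borel_measurable borel"
  shows integrable_radial: "integrable lborel (\<lambda>x::'a::euclidean_space. u (norm x)) \<longleftrightarrow>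
      set_integrable lborel {0..} (\<lambda>r. r ^ (DIM('a) - 1) *\<^sub>R u r)" (is ?A)
    and integral_radial: "(LINT x::'a|lborel. u (norm x)) =
      (DIM('a) * measure lborel (ball (0::'a) 1)) *\<^sub>R (LINT r:{0..}|lborel. r ^ (DIM('a) - 1) *\<^sub>R u r)" (is ?B)
proof -
  define K where "K = DIM('a) * measure lborel (ball (0::'a) 1)"
  have K: "K > 0" by (simp add: K_def content_ball_pos)
  define w where "w r = indicator {0..} r * (K * r ^ (DIM('a) - 1))" for r :: real
  have [measurable]: "w \<in> borel_measurable borel" unfolding w_def by measurable
  have w0: "w r \<ge> 0" for r using K by (auto simp: w_def indicator_def)
  have D: "distr lborel borel (norm :: 'a \<Rightarrow> real) = density lborel (\<lambda>r. ennreal (w r))"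
    using distr_norm_lborel[where 'a='a] by (simp add: w_def K_def mult.assoc)
  have wu: "w r *\<^sub>R u r = K *\<^sub>R (indicator {0..} r *\<^sub>R (r ^ (DIM('a) - 1) *\<^sub>R u r))" for r
    by (simp add: w_def)
  have "integrable lborel (\<lambda>x::'a. u (norm x)) \<longleftrightarrow> integrable (distr lborel borel (norm :: 'a \<Rightarrow> real)) u"
    by (subst integrable_distr_eq) auto
  also have "\<dots> \<longleftrightarrow> integrable lborel (\<lambda>r. w r *\<^sub>R u r)"
    unfolding D using w0 by (subst integrable_density) auto
  also have "\<dots> \<longleftrightarrow> set_integrable lborel {0..} (\<lambda>r. r ^ (DIM('a) - 1) *\<^sub>R u r)"
    unfolding wu set_integrable_def
  proof
    assume "integrable lborel (\<lambda>r. K *\<^sub>R (indicator {0..} r *\<^sub>R (r ^ (DIM('a) - 1) *\<^sub>R u r)))"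
    hence "integrable lborel (\<lambda>r. inverse K *\<^sub>R K *\<^sub>R (indicator {0..} r *\<^sub>R (r ^ (DIM('a) - 1) *\<^sub>R u r)))"
      by (rule integrable_scaleR_right)
    thus "integrable lborel (\<lambda>r. indicator {0..} r *\<^sub>R (r ^ (DIM('a) - 1) *\<^sub>R u r))" using K by (simp flip: mult.assoc)
  qed (rule integrable_scaleR_right)
  finally show ?A .
  have "(LINT x::'a|lborel. u (norm x)) = (LINT r|distr lborel borel (norm :: 'a \<Rightarrow> real). u r)"
    by (subst integral_distr) auto
  also have "\<dots> = (LINT r|lborel. w r *\<^sub>R u r)"
    unfolding D using w0 by (subst integral_density) auto
  also have "\<dots> = K *\<^sub>R (LINT r:{0..}|lborel. r ^ (DIM('a) - 1) *\<^sub>R u r)"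
    unfolding wu set_lebesgue_integral_def by (rule integral_scaleR_right)
  finally show ?B by (simp add: K_def)
qed

text \<open>
  The difference quotients of the norm are dominated by \<open>norm (h x)\<close> and converge, wherever
  \<open>f x\<close> does not vanish, to \<open>sgn (f x) \<bullet> h x\<close>. For complex values this inner product is the real part
  of \<open>cnj (sgn (f x)) * h x\<close>.
\<close>

lemma L1_minimum_pairing_nonneg:
  fixes f h :: "'a \<Rightarrow> 'b::euclidean_space"
  assumes f: "integrable M f" and h: "integrable M h" and nz: "AE x in M. f x \<noteq> 0"
    and min: "\<And>t. 0 < t \<Longrightarrow> (LINT x|M. norm (f x)) \<le> (LINT x|M. norm (f x + t *\<^sub>R h x))"
  shows "0 \<le> (LINT x|M. sgn (f x) \<bullet> h x)"
proof -
  have [measurable]: "f \<in> borel_measurable M" "h \<in> borel_measurable M" using f h by auto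
  define t where "t n = inverse (real (Suc n))" for n
  have t: "t n > 0" for n by (simp add: t_def)
  define q where "q n x = (norm (f x + t n *\<^sub>R h x) - norm (f x)) / t n" for n x
  have "(\<lambda>n. LINT x|M. q n x) \<longlonglongrightarrow> (LINT x|M. sgn (f x) \<bullet> h x)"
  proof (rule integral_dominated_convergence)
    show "integrable M (\<lambda>x. norm (h x))" using h by simp
    show "(\<lambda>x. sgn (f x) \<bullet> h x) \<in> borel_measurable M"
      unfolding sgn_div_norm by measurable
    show "q n \<in> borel_measurable M" for n unfolding q_def by measurable
    show "AE x in M. norm (q n x) \<le> norm (h x)" for n
    proof (rule AE_I2)
      fix x
      have "\<bar>norm (f x + t n *\<^sub>R h x) - norm (f x)\<bar> \<le> t n * norm (h x)"
        using norm_triangle_ineq3[of "f x + t n *\<^sub>R h x" "f x"] t[of n] by simp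
      thus "norm (q n x) \<le> norm (h x)" using t[of n] by (simp add: q_def pos_divide_le_eq mult.commute)
    qed
    show "AE x in M. (\<lambda>n. q n x) \<longlonglongrightarrow> sgn (f x) \<bullet> h x"
      using nz
    proof eventually_elim
      case (elim x)
      have "((\<lambda>s. norm (f x + s *\<^sub>R h x)) has_derivative (\<lambda>s. sgn (f x) \<bullet> (s *\<^sub>R h x))) (at 0)"
      proof -
        have "(norm has_derivative (\<lambda>y. sgn (f x) \<bullet> y)) (at (f x + 0 *\<^sub>R h x))"
          using has_derivative_norm[OF elim] by (simp add: inner_commute)
        moreover have "((\<lambda>s. f x + s *\<^sub>R h x) has_derivative (\<lambda>s. s *\<^sub>R h x)) (at 0)"
          by (auto intro!: derivative_eq_intros)
        ultimately show ?thesis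
          by (rule has_derivative_compose[rotated])
      qed
      hence "((\<lambda>s. norm (f x + s *\<^sub>R h x)) has_real_derivative sgn (f x) \<bullet> h x) (at 0)"
        by (rule has_derivative_imp_has_field_derivative) simp
      hence "((\<lambda>s. (norm (f x + s *\<^sub>R h x) - norm (f x)) / s) \<longlongrightarrow> sgn (f x) \<bullet> h x) (at 0)"
        by (simp add: DERIV_def)
      moreover have "filterlim t (at 0) sequentially"
        unfolding filterlim_at t_def[abs_def] using LIMSEQ_inverse_real_of_nat by auto
      ultimately show ?case unfolding q_def by (rule filterlim_compose)
    qed
  qed
  moreover have "0 \<le> (LINT x|M. q n x)" for n
  proof -
    have "integrable M (\<lambda>x. norm (f x + t n *\<^sub>R h x))" using f h by auto
    hence "(LINT x|M. q n x) = ((LINT x|M. norm (f x + t n *\<^sub>R h x)) - (LINT x|M. norm (f x))) / t n"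
      unfolding q_def using f by simp
    thus ?thesis using min[OF t] t[of n] by simp
  qed
  ultimately show ?thesis by (intro LIMSEQ_le_const) auto
qed

lemma L1_minimum_orthogonality:
  fixes f h :: "'a \<Rightarrow> 'b::euclidean_space"
  assumes f: "integrable M f" and h: "integrable M h" and nz: "AE x in M. f x \<noteq> 0"
    and min: "\<And>t. (LINT x|M. norm (f x)) \<le> (LINT x|M. norm (f x + t *\<^sub>R h x))"
  shows "(LINT x|M. sgn (f x) \<bullet> h x) = 0"
proof (rule antisym)
  show "0 \<le> (LINT x|M. sgn (f x) \<bullet> h x)"
    by (rule L1_minimum_pairing_nonneg[OF f h nz min])
  have "0 \<le> (LINT x|M. sgn (f x) \<bullet> (- h x))"
    by (rule L1_minimum_pairing_nonneg[OF f _ nz]) (use h min[of "- t" for t] in auto)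
  thus "(LINT x|M. sgn (f x) \<bullet> h x) \<le> 0" by simp
qed

section \<open>Radial profiles and the Paley-Wiener class\<close>

text \<open>
  Even entire functions of exponential type at most 1, expressed in terms of the square of the variable.
\<close>

definition radial_profile :: "(complex \<Rightarrow> complex) \<Rightarrow> bool" where
  "radial_profile f \<longleftrightarrow> f holomorphic_on UNIV \<and>
     (\<forall>\<epsilon>>0. \<exists>A. \<forall>w. norm (f w) \<le> A * exp ((1 + \<epsilon>) * sqrt (norm w)))"

lemma radial_profile_holomorphic: "radial_profile f \<Longrightarrow> f holomorphic_on UNIV"
  by (simp add: radial_profile_def)

lemma radial_profile_growth:
  assumes "radial_profile f" "\<epsilon> > 0"
  obtains A where "A \<ge> 0" "\<And>w. norm (f w) \<le> A * exp ((1 + \<epsilon>) * sqrt (norm w))"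
proof -
  obtain A where A: "\<And>w. norm (f w) \<le> A * exp ((1 + \<epsilon>) * sqrt (norm w))"
    using assms by (auto simp: radial_profile_def)
  have "A \<ge> 0" using A[of 0] by (smt (verit) exp_gt_zero norm_ge_zero zero_le_mult_iff)
  thus ?thesis using A that by blast
qed

lemma radial_profile_add:
  assumes f: "radial_profile f" and g: "radial_profile g"
  shows "radial_profile (\<lambda>w. f w + g w)"
  unfolding radial_profile_def
proof (intro conjI allI impI)
  show "(\<lambda>w. f w + g w) holomorphic_on UNIV"
    using assms by (intro holomorphic_intros radial_profile_holomorphic)
  fix \<epsilon> :: real assume e: "\<epsilon> > 0"
  obtain A where A: "\<And>w. norm (f w) \<le> A * exp ((1 + \<epsilon>) * sqrt (norm w))"
    using radial_profile_growth[OF f e] by metis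
  obtain B where B: "\<And>w. norm (g w) \<le> B * exp ((1 + \<epsilon>) * sqrt (norm w))"
    using radial_profile_growth[OF g e] by metis
  show "\<exists>A. \<forall>w. norm (f w + g w) \<le> A * exp ((1 + \<epsilon>) * sqrt (norm w))"
  proof (intro exI allI)
    show "norm (f w + g w) \<le> (A + B) * exp ((1 + \<epsilon>) * sqrt (norm w))" for w
      using norm_triangle_ineq[of "f w" "g w"] A[of w] B[of w] by (simp add: distrib_right)
  qed
qed

lemma radial_profile_cmult:
  assumes f: "radial_profile f"
  shows "radial_profile (\<lambda>w. c * f w)"
  unfolding radial_profile_def
proof (intro conjI allI impI)
  show "(\<lambda>w. c * f w) holomorphic_on UNIV"
    using assms by (intro holomorphic_intros radial_profile_holomorphic)
  fix \<epsilon> :: real assume e: "\<epsilon> > 0"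
  obtain A where A: "\<And>w. norm (f w) \<le> A * exp ((1 + \<epsilon>) * sqrt (norm w))"
    using radial_profile_growth[OF f e] by metis
  show "\<exists>A. \<forall>w. norm (c * f w) \<le> A * exp ((1 + \<epsilon>) * sqrt (norm w))"
  proof (intro exI allI)
    show "norm (c * f w) \<le> (norm c * A) * exp ((1 + \<epsilon>) * sqrt (norm w))" for w
      using mult_left_mono[OF A[of w], of "norm c"] by (simp add: norm_mult)
  qed
qed

text \<open>
  A factor of polynomial growth is absorbed by an arbitrarily small part of \<open>\<epsilon>\<close>.
\<close>

lemma radial_profile_times_id:
  assumes f: "radial_profile f"
  shows "radial_profile (\<lambda>w. w * f w)"
  unfolding radial_profile_def
proof (intro conjI allI impI)
  show "(\<lambda>w. w * f w) holomorphic_on UNIV"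
    using assms by (intro holomorphic_intros radial_profile_holomorphic)
  fix \<epsilon> :: real assume e: "\<epsilon> > 0"
  define \<eta> where "\<eta> = \<epsilon> / 2"
  have \<eta>: "\<eta> > 0" using e by (simp add: \<eta>_def)
  obtain A where A: "A \<ge> 0" "\<And>w. norm (f w) \<le> A * exp ((1 + \<eta>) * sqrt (norm w))"
    using radial_profile_growth[OF f \<eta>] by metis
  show "\<exists>A. \<forall>w. norm (w * f w) \<le> A * exp ((1 + \<epsilon>) * sqrt (norm w))"
  proof (intro exI allI)
    fix w :: complex
    define s where "s = sqrt (norm w)"
    have s: "s \<ge> 0" "norm w = s\<^sup>2" by (auto simp: s_def)
    have "(\<eta> * s)\<^sup>2 / 2 \<le> exp (\<eta> * s)"
      using exp_lower_Taylor_quadratic[of "\<eta> * s"] s \<eta> by (smt (verit) mult_nonneg_nonneg)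
    hence w: "norm w \<le> (2 / \<eta>\<^sup>2) * exp (\<eta> * s)"
      using \<eta> unfolding s by (simp add: field_simps)
    have "norm (w * f w) \<le> ((2 / \<eta>\<^sup>2) * exp (\<eta> * s)) * (A * exp ((1 + \<eta>) * s))"
      unfolding norm_mult using w A(2)[of w] by (intro mult_mono) (auto simp: s_def)
    also have "\<dots> = (2 / \<eta>\<^sup>2 * A) * (exp (\<eta> * s) * exp ((1 + \<eta>) * s))" by simp
    also have "exp (\<eta> * s) * exp ((1 + \<eta>) * s) = exp ((1 + \<epsilon>) * s)"
      unfolding mult_exp_exp by (simp add: \<eta>_def algebra_simps)
    finally show "norm (w * f w) \<le> (2 / \<eta>\<^sup>2 * A) * exp ((1 + \<epsilon>) * sqrt (norm w))" by (simp add: s_def)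
  qed
qed

text \<open>
  At distance at least 1 from \<open>a\<close> the quotient is dominated by \<open>f\<close>; near \<open>a\<close> it is bounded by
  compactness.
\<close>

lemma radial_profile_divide:
  assumes f: "radial_profile f" and g: "g holomorphic_on UNIV"
    and fg: "\<And>w. f w = (w - a) * g w"
  shows "radial_profile g"
  unfolding radial_profile_def
proof (intro conjI allI impI g)
  fix \<epsilon> :: real assume e: "\<epsilon> > 0"
  obtain A where A: "A \<ge> 0" "\<And>w. norm (f w) \<le> A * exp ((1 + \<epsilon>) * sqrt (norm w))"
    using radial_profile_growth[OF f e] by metis
  have "compact (g ` cball a 1)"
    using g by (intro compact_continuous_image holomorphic_on_imp_continuous_on) (auto intro: holomorphic_on_subset)
  then obtain B where B: "B > 0" "\<forall>y \<in> g ` cball a 1. norm y \<le> B"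
    using compact_imp_bounded bounded_pos by blast
  show "\<exists>A. \<forall>w. norm (g w) \<le> A * exp ((1 + \<epsilon>) * sqrt (norm w))"
  proof (intro exI allI)
    fix w :: complex
    have E: "exp ((1 + \<epsilon>) * sqrt (norm w)) \<ge> 1"
      unfolding one_le_exp_iff using e by (intro mult_nonneg_nonneg) auto
    show "norm (g w) \<le> (A + B) * exp ((1 + \<epsilon>) * sqrt (norm w))"
    proof (cases "w \<in> cball a 1")
      case True
      hence "norm (g w) \<le> B * 1" using B by simp
      also have "\<dots> \<le> (A + B) * exp ((1 + \<epsilon>) * sqrt (norm w))"
        using A(1) B(1) E by (intro mult_mono) auto
      finally show ?thesis .
    next
      case False
      hence "1 \<le> norm (w - a)" by (simp add: dist_norm norm_minus_commute)
      hence "norm (g w) \<le> norm (f w)" unfolding fg norm_mult by (simp add: mult_le_cancel_right1)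
      also have "\<dots> \<le> A * exp ((1 + \<epsilon>) * sqrt (norm w))" by (rule A)
      also have "\<dots> \<le> (A + B) * exp ((1 + \<epsilon>) * sqrt (norm w))"
        using B(1) by (intro mult_right_mono) auto
      finally show ?thesis .
    qed
  qed
qed

text \<open>
  A Cauchy estimate on unit circles, together with
  \<open>sqrt (norm v) \<le> sqrt (norm w) + 1\<close> for \<open>v\<close> on the unit circle about \<open>w\<close>.
\<close>

lemma radial_profile_deriv:
  assumes f: "radial_profile f"
  shows "radial_profile (deriv f)"
  unfolding radial_profile_def
proof (intro conjI allI impI)
  show "deriv f holomorphic_on UNIV"
    using radial_profile_holomorphic[OF f] by (rule holomorphic_deriv) simp
  fix \<epsilon> :: real assume e: "\<epsilon> > 0"
  obtain A where A: "A \<ge> 0" "\<And>w. norm (f w) \<le> A * exp ((1 + \<epsilon>) * sqrt (norm w))"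
    using radial_profile_growth[OF f e] by metis
  show "\<exists>A. \<forall>w. norm (deriv f w) \<le> A * exp ((1 + \<epsilon>) * sqrt (norm w))"
  proof (intro exI allI)
    fix w :: complex
    show "norm (deriv f w) \<le> A * exp (1 + \<epsilon>) * exp ((1 + \<epsilon>) * sqrt (norm w))"
    proof (rule entire_deriv_bound[OF radial_profile_holomorphic[OF f]])
      fix v assume "norm (v - w) = 1"
      hence "norm v \<le> norm w + 1" using norm_triangle_ineq2[of v w] by simp
      also have "\<dots> \<le> (sqrt (norm w) + 1)\<^sup>2" by (simp add: power2_eq_square algebra_simps)
      finally have "sqrt (norm v) \<le> sqrt (norm w) + 1" by (intro real_le_lsqrt) auto
      hence "(1 + \<epsilon>) * sqrt (norm v) \<le> (1 + \<epsilon>) * (sqrt (norm w) + 1)"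
        using e by (intro mult_left_mono) auto
      hence "exp ((1 + \<epsilon>) * sqrt (norm v)) \<le> exp (1 + \<epsilon>) * exp ((1 + \<epsilon>) * sqrt (norm w))"
        unfolding mult_exp_exp by (simp add: algebra_simps)
      hence "A * exp ((1 + \<epsilon>) * sqrt (norm v)) \<le> A * (exp (1 + \<epsilon>) * exp ((1 + \<epsilon>) * sqrt (norm w)))"
        using A(1) by (rule mult_left_mono)
      thus "norm (f v) \<le> A * exp (1 + \<epsilon>) * exp ((1 + \<epsilon>) * sqrt (norm w))"
        using A(2)[of v] by simp
    qed
  qed
qed

text \<open>
  The odd part of the Taylor series at 0 vanishes; the even part is a power series in
  the square of the variable.
\<close>

lemma even_entire_eq_square:
  fixes f :: "complex \<Rightarrow> complex"
  assumes hol: "f holomorphic_on UNIV" and even: "\<And>z. f (- z) = f z"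
  obtains g where "g holomorphic_on UNIV" "\<And>z. f z = g (z\<^sup>2)"
proof -
  define a where "a n = (deriv ^^ n) f 0 / fact n" for n
  have f: "(\<lambda>n. a n * z ^ n) sums f z" for z
    using holomorphic_power_series[of f 0 "norm z + 1" z] hol
    by (auto simp: a_def intro: holomorphic_on_subset)
  have f2: "(\<lambda>n. a (2 * n) * (z\<^sup>2) ^ n) sums f z" for z
  proof -
    define b where "b n = (a n * z ^ n + a n * (- z) ^ n) / 2" for n
    have "b sums ((f z + f (- z)) / 2)"
      unfolding b_def by (intro sums_divide sums_add f)
    hence b: "b sums f z" using even by simp
    have "(\<lambda>n. b (2 * n)) sums f z"
    proof (subst sums_mono_reindex)
      show "strict_mono (\<lambda>n::nat. 2 * n)" by (auto simp: strict_mono_def)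
      show "b n = 0" if "n \<notin> range (\<lambda>n. 2 * n)" for n
      proof -
        have "odd n" using that by (metis evenE rangeI)
        thus ?thesis by (simp add: b_def)
      qed
    qed (rule b)
    moreover have "b (2 * n) = a (2 * n) * (z\<^sup>2) ^ n" for n
      by (simp add: b_def power_mult)
    ultimately show ?thesis by simp
  qed
  define g where "g w = f (csqrt w)" for w
  have g: "(\<lambda>n. a (2 * n) * w ^ n) sums g w" for w
    using f2[of "csqrt w"] by (simp add: g_def)
  have "g holomorphic_on ball 0 r" for r
    by (rule power_series_holomorphic[of 0 r "\<lambda>n. a (2 * n)"]) (use g in simp)
  hence "g field_differentiable at w" for w
    by (rule holomorphic_on_imp_differentiable_at[of _ "ball 0 (norm w + 1)"]) auto
  hence "g holomorphic_on UNIV" by (simp add: holomorphic_on_def field_differentiable_at_within)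
  moreover have "f z = g (z\<^sup>2)" for z using sums_unique2[OF f2[of z] g[of "z\<^sup>2"]] .
  ultimately show ?thesis using that by blast
qed

lemma norm_sum_squares_le:
  fixes z :: "complex ^ 'n::finite"
  shows "sqrt (norm (\<Sum>i\<in>UNIV. (z $ i)\<^sup>2)) \<le> norm z"
proof -
  have "norm (\<Sum>i\<in>UNIV. (z $ i)\<^sup>2) \<le> (\<Sum>i\<in>UNIV. (norm (z $ i))\<^sup>2)"
    by (rule order_trans[OF norm_sum]) (simp add: norm_power)
  thus ?thesis unfolding norm_vec_def L2_set_def by (rule real_sqrt_le_mono)
qed

text \<open>
  The entire extension is \<open>f\<close> applied to the sum of the squared coordinates, a sum of modulus at most
  the square of the Hermitian norm. This is why the square root in the growth condition of a profile
  matches spherical exponential type.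
\<close>

lemma radial_profile_in_PW:
  assumes f: "radial_profile f"
    and int: "integrable lborel (\<lambda>x :: real ^ 'n::finite. f ((of_real (norm x))\<^sup>2))"
  shows "(\<lambda>x :: real ^ 'n. f ((of_real (norm x))\<^sup>2)) \<in> PW 1 1"
proof -
  define F where "F z = f (\<Sum>i\<in>UNIV. (z $ i)\<^sup>2)" for z :: "complex ^ 'n"
  have "entire_multi F"
    unfolding entire_multi_def
  proof
    fix z :: "complex ^ 'n"
    define s where "s = (\<Sum>i\<in>UNIV. (z $ i)\<^sup>2)"
    have 1: "(f has_derivative (*) (deriv f s)) (at s)"
      using holomorphic_derivI[OF radial_profile_holomorphic[OF f]] by (simp add: has_field_derivative_def)
    have 2: "((\<lambda>z. \<Sum>i\<in>UNIV. (z $ i)\<^sup>2) has_derivative (\<lambda>v. \<Sum>i\<in>UNIV. 2 * (z $ i * v $ i))) (at z)"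
    proof (rule has_derivative_sum)
      fix i :: 'n
      have "((\<lambda>z. z $ i) has_derivative (\<lambda>v. v $ i)) (at z)"
        by (rule bounded_linear_imp_has_derivative[OF bounded_linear_vec_nth])
      from has_derivative_power[OF this, of 2]
      show "((\<lambda>z. (z $ i)\<^sup>2) has_derivative (\<lambda>v. 2 * (z $ i * v $ i))) (at z)"
        by (simp add: mult_ac)
    qed
    have "(F has_derivative (\<lambda>v. deriv f s * (\<Sum>i\<in>UNIV. 2 * (z $ i * v $ i)))) (at z)"
      unfolding F_def[abs_def] using has_derivative_compose[OF 2] 1 by (simp add: s_def)
    moreover have "deriv f s * (\<Sum>i\<in>UNIV. 2 * (z $ i * (c *s v) $ i)) =
        c * (deriv f s * (\<Sum>i\<in>UNIV. 2 * (z $ i * v $ i)))" for c v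
      by (simp add: sum_distrib_left mult_ac)
    ultimately show "\<exists>F'. (F has_derivative F') (at z) \<and> (\<forall>c v. F' (c *s v) = c * F' v)" by blast
  qed
  moreover have "spherical_exp_type_le 1 F"
    unfolding spherical_exp_type_le_def
  proof (intro allI impI)
    fix \<epsilon> :: real assume e: "\<epsilon> > 0"
    obtain A where A: "A \<ge> 0" "\<And>w. norm (f w) \<le> A * exp ((1 + \<epsilon>) * sqrt (norm w))"
      using radial_profile_growth[OF f e] by metis
    show "\<exists>A. \<forall>z. norm (F z) \<le> A * exp ((1 + \<epsilon>) * norm z)"
    proof (intro exI allI)
      fix z
      have "norm (F z) \<le> A * exp ((1 + \<epsilon>) * sqrt (norm (\<Sum>i\<in>UNIV. (z $ i)\<^sup>2)))"
        unfolding F_def by (rule A)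
      also have "\<dots> \<le> A * exp ((1 + \<epsilon>) * norm z)"
        using norm_sum_squares_le[of z] e A(1) by (intro mult_left_mono) auto
      finally show "norm (F z) \<le> A * exp ((1 + \<epsilon>) * norm z)" .
    qed
  qed
  moreover have "f ((of_real (norm x))\<^sup>2) = F (complexify x)" for x
  proof -
    have "(norm x)\<^sup>2 = (\<Sum>i\<in>UNIV. (x $ i)\<^sup>2)"
      by (simp add: norm_vec_def L2_set_def sum_nonneg)
    hence "(of_real (norm x))\<^sup>2 = (\<Sum>i\<in>UNIV. (complexify x $ i)\<^sup>2)"
      by (simp add: complexify_def flip: of_real_power of_real_sum)
    thus ?thesis by (simp add: F_def)
  qed
  moreover have "integrable lborel (\<lambda>x :: real ^ 'n. norm (f ((of_real (norm x))\<^sup>2)) powr 1)"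
    using integrable_norm[OF int] by simp
  ultimately show ?thesis unfolding PW_def by blast
qed

lemma norm_axis: "norm (axis i c :: 'a::real_normed_vector ^ 'n::finite) = norm c"
proof -
  have "(\<Sum>j\<in>UNIV. (norm ((axis i c :: 'a ^ 'n) $ j))\<^sup>2) = (\<Sum>j\<in>UNIV. if j = i then (norm c)\<^sup>2 else 0)"
    by (intro sum.cong) (auto simp: axis_def)
  thus ?thesis by (simp add: norm_vec_def L2_set_def)
qed

text \<open>
  On a coordinate axis the entire extension \<open>F\<close> agrees with \<open>f\<close> at real points, hence at
  all complex points of the complexified axis, so \<open>f\<close> inherits the exponential type of \<open>F\<close>.
\<close>

lemma radial_PW_profile:
  fixes f :: "complex \<Rightarrow> complex"
  assumes hol: "f holomorphic_on UNIV" and even: "\<And>z. f (- z) = f z"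
    and PW: "(\<lambda>x :: real ^ 'n::finite. f (of_real (norm x))) \<in> PW 1 1"
  obtains g where "radial_profile g" "\<And>z. f z = g (z\<^sup>2)"
    "integrable lborel (\<lambda>x :: real ^ 'n. g ((of_real (norm x))\<^sup>2))"
proof -
  obtain g where g: "g holomorphic_on UNIV" "\<And>z. f z = g (z\<^sup>2)"
    using even_entire_eq_square[OF hol even] by blast
  obtain F :: "complex ^ 'n \<Rightarrow> complex" where F: "entire_multi F" "spherical_exp_type_le 1 F"
    "\<And>x. f (of_real (norm x)) = F (complexify x)"
    and int: "integrable lborel (\<lambda>x :: real ^ 'n. norm (f (of_real (norm x))))"
    using PW by (auto simp: PW_def)
  obtain i :: 'n where True by simp
  define e :: "complex ^ 'n" where "e = axis i 1"
  have f_line: "f z = F (z *s e)" for z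
  proof -
    have line: "((\<lambda>z. F (z *s e)) has_field_derivative F' e) (at z)"
      if F': "(F has_derivative F') (at (z *s e))" "\<forall>c v. F' (c *s v) = c * F' v" for F' z
    proof -
      have "bounded_linear (\<lambda>z. z *s e)"
        by (rule linear_conv_bounded_linear[THEN iffD1], rule linearI)
           (auto simp: vec_eq_iff algebra_simps)
      hence "((\<lambda>z. z *s e) has_derivative (\<lambda>z. z *s e)) (at z)"
        by (rule bounded_linear_imp_has_derivative)
      from has_derivative_compose[OF this F'(1)]
      moreover have "(*) (F' e) = (\<lambda>c. F' (c *s e))" using F'(2) by (auto simp: mult.commute)
      ultimately show ?thesis by (simp add: has_field_derivative_def)
    qed
    have "(\<lambda>z. F (z *s e)) holomorphic_on UNIV"
    proof (rule holomorphic_onI)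
      fix z
      obtain F' where "(F has_derivative F') (at (z *s e))" "\<forall>c v. F' (c *s v) = c * F' v"
        using F(1) unfolding entire_multi_def by blast
      from line[OF this] show "(\<lambda>z. F (z *s e)) field_differentiable at z within UNIV"
        unfolding field_differentiable_def by (intro exI)
    qed
    hence h: "(\<lambda>z. f z - F (z *s e)) holomorphic_on UNIV" by (intro holomorphic_intros hol)
    have "f z - F (z *s e) = 0"
    proof (rule analytic_continuation[OF h, where U = "\<real>" and \<xi> = 0])
      show "(0::complex) islimpt \<real>"
        unfolding islimpt_approachable
      proof (intro allI impI)
        fix r :: real assume "r > 0"
        thus "\<exists>x'\<in>\<real>. x' \<noteq> (0::complex) \<and> dist x' 0 < r"
          by (intro bexI[of _ "of_real (r / 2)"]) (auto simp: dist_norm)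
      qed
      fix w :: complex assume "w \<in> \<real>"
      then obtain t where t: "w = of_real t" by (auto elim: Reals_cases)
      have "f w = f (of_real (norm (axis i t :: real ^ 'n)))"
        using even[of w] by (auto simp: t norm_axis abs_if)
      also have "\<dots> = F (complexify (axis i t))" by (rule F(3))
      also have "complexify (axis i t) = w *s e"
        by (auto simp: complexify_def vec_eq_iff axis_def e_def t)
      finally show "f w - F (w *s e) = 0" by simp
    qed auto
    thus ?thesis by simp
  qed
  have "radial_profile g"
    unfolding radial_profile_def
  proof (intro conjI allI impI g(1))
    fix \<epsilon> :: real assume "\<epsilon> > 0"
    then obtain A where A: "\<And>z. norm (F z) \<le> A * exp ((1 + \<epsilon>) * norm z)"
      using F(2) unfolding spherical_exp_type_le_def by blast
    show "\<exists>A. \<forall>w. norm (g w) \<le> A * exp ((1 + \<epsilon>) * sqrt (norm w))"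
    proof (intro exI allI)
      fix w :: complex
      have "norm (csqrt w *s e) = sqrt (norm w)"
      proof -
        have "csqrt w *s e = axis i (csqrt w)" by (simp add: e_def vec_eq_iff axis_def)
        thus ?thesis by (simp add: norm_axis norm_csqrt)
      qed
      thus "norm (g w) \<le> A * exp ((1 + \<epsilon>) * sqrt (norm w))"
        using A[of "csqrt w *s e"] g(2)[of "csqrt w"] by (simp add: f_line)
    qed
  qed
  moreover have "integrable lborel (\<lambda>x :: real ^ 'n. g ((of_real (norm x))\<^sup>2))"
  proof -
    have "continuous_on UNIV g" using g(1) by (rule holomorphic_on_imp_continuous_on)
    hence "continuous_on UNIV (\<lambda>x :: real ^ 'n. g ((of_real (norm x))\<^sup>2))"
      by (rule continuous_on_compose2) (auto intro!: continuous_intros)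
    hence "(\<lambda>x :: real ^ 'n. g ((of_real (norm x))\<^sup>2)) \<in> borel_measurable lborel"
      using borel_measurable_continuous_onI by simp
    thus ?thesis using int by (subst integrable_norm_iff[symmetric]) (auto simp: g(2))
  qed
  ultimately show ?thesis using g(2) that by blast
qed

section \<open>The extremality condition and the location of zeros\<close>

definition radial :: "(complex \<Rightarrow> complex) \<Rightarrow> real ^ 'n::finite \<Rightarrow> complex" where
  "radial f x = f ((complex_of_real (norm x))\<^sup>2)"

definition extremal_profile :: "'n::finite itself \<Rightarrow> (complex \<Rightarrow> complex) \<Rightarrow> bool" where
  "extremal_profile _ f \<longleftrightarrow> radial_profile f \<and> f 0 = 1 \<and>
     integrable lborel (radial f :: real ^ 'n \<Rightarrow> complex) \<and>
     nikolskii_extremal (radial f :: real ^ 'n \<Rightarrow> complex)"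

lemma continuous_on_radial:
  assumes "f holomorphic_on UNIV"
  shows "continuous_on UNIV (radial f :: real ^ 'n::finite \<Rightarrow> complex)"
proof -
  have "continuous_on UNIV f" using assms by (rule holomorphic_on_imp_continuous_on)
  thus ?thesis unfolding radial_def[abs_def]
    by (rule continuous_on_compose2) (auto intro!: continuous_intros)
qed

lemma radial_measurable:
  assumes "f holomorphic_on UNIV"
  shows "(radial f :: real ^ 'n::finite \<Rightarrow> complex) \<in> borel_measurable borel"
  by (rule borel_measurable_continuous_onI[OF continuous_on_radial[OF assms]])

lemma inner_sgn_mult: "sgn z \<bullet> (c * z) = Re c * norm z" for c z :: complex
proof -
  have "z \<bullet> (c * z) = Re c * (norm z)\<^sup>2"
    by (simp only: cmod_power2) (simp add: inner_complex_def power2_eq_square algebra_simps)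
  thus ?thesis by (simp add: sgn_div_norm power2_eq_square divide_simps)
qed

lemma finite_zeros_in_cball:
  assumes "f holomorphic_on UNIV" "f 0 = 1"
  shows "finite {z \<in> cball 0 r. f z = (0::complex)}"
proof (cases "f constant_on UNIV")
  case True
  hence "f z = 1" for z using assms(2) by (metis UNIV_I constant_on_def)
  thus ?thesis by simp
next
  case False
  show ?thesis
    by (rule holomorphic_compact_finite_zeros[OF assms(1)]) (use False in auto)
qed

lemma not_AE_lborel_False: "\<not> (AE x :: 'a::euclidean_space in lborel. False)"
proof
  assume "AE x :: 'a in lborel. False"
  hence "emeasure lborel (UNIV :: 'a set) = 0"
    using ae_filter_eq_bot_iff[of "lborel :: 'a measure"] by (simp add: trivial_limit_def)
  thus False by simp
qed

text \<open>
  The zeros of a nonconstant entire function are countable, so the zeros of the radial function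
  lie on countably many spheres.
\<close>

lemma AE_radial_nonzero:
  assumes f: "f holomorphic_on UNIV" "f 0 = 1"
  shows "AE x :: real ^ 'n::finite in lborel. radial f x \<noteq> 0 \<and> x \<noteq> 0"
proof -
  define Z where "Z = (\<Union>n::nat. {z \<in> cball 0 (real n). f z = 0})"
  have Z: "countable Z" unfolding Z_def
    by (intro countable_UN countableI_type countable_finite finite_zeros_in_cball[OF f])
  have zZ: "z \<in> Z" if "f z = 0" for z
    using that real_arch_simple[of "norm z"] by (auto simp: Z_def)
  define N where "N = (\<Union>z\<in>insert 0 Z. sphere (0 :: real ^ 'n) (sqrt (Re z)))"
  have "N \<in> null_sets lborel"
    unfolding N_def
  proof (rule null_sets_UN')
    show "countable (insert 0 Z)" using Z by simp
    fix z
    have "sphere (0 :: real ^ 'n) (sqrt (Re z)) \<in> null_sets lebesgue"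
      using negligible_sphere negligible_iff_null_sets by blast
    thus "sphere (0 :: real ^ 'n) (sqrt (Re z)) \<in> null_sets lborel"
      by (simp add: null_sets_completion_iff)
  qed
  moreover have "x \<in> N" if "\<not> (radial f x \<noteq> 0 \<and> x \<noteq> 0)" for x :: "real ^ 'n"
  proof (cases "x = 0")
    case True
    thus ?thesis by (auto simp: N_def)
  next
    case False
    hence "(complex_of_real (norm x))\<^sup>2 \<in> Z" using that zZ by (auto simp: radial_def)
    moreover have "x \<in> sphere 0 (sqrt (Re ((complex_of_real (norm x))\<^sup>2)))"
      by (simp flip: of_real_power)
    ultimately show ?thesis unfolding N_def by blast
  qed
  ultimately show ?thesis by (intro AE_I') auto
qed

text \<open>
  The extremality condition. The difference \<open>g - g 0 * f\<close> vanishes at the origin, so it is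
  an admissible direction of variation, and the first variation of the \<open>L\<^sup>1\<close> norm along it vanishes.
\<close>

lemma extremal_orthogonality:
  fixes f g :: "complex \<Rightarrow> complex"
  assumes ext: "extremal_profile TYPE('n::finite) f"
    and g: "radial_profile g" "integrable lborel (radial g :: real ^ 'n \<Rightarrow> complex)"
  shows "(LINT x :: real ^ 'n|lborel. sgn (radial f x) \<bullet> radial g x) =
    Re (g 0) * L1_norm (radial f :: real ^ 'n \<Rightarrow> complex)"
proof -
  define F G :: "real ^ 'n \<Rightarrow> complex" where "F = radial f" and "G = radial g"
  define H where "H x = G x + (- g 0) * F x" for x
  define h where "h w = g w + (- g 0) * f w" for w
  have f: "radial_profile f" "f 0 = 1" "integrable lborel F" "nikolskii_extremal F"
    using ext by (auto simp: extremal_profile_def F_def)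
  have h: "radial_profile h" "h 0 = 0"
    unfolding h_def by (intro radial_profile_add radial_profile_cmult f g) (simp add: f(2))
  have H: "integrable lborel H" unfolding H_def[abs_def] G_def using f(3) g(2)
    by (intro Bochner_Integration.integrable_add integrable_mult_right) auto
  have Hh: "H = radial h" by (auto simp: H_def h_def F_def G_def radial_def)
  have "(LINT x|lborel. sgn (F x) \<bullet> H x) = 0"
  proof (rule L1_minimum_orthogonality[OF f(3) H])
    show "AE x in lborel. F x \<noteq> 0"
      using AE_radial_nonzero[OF radial_profile_holomorphic[OF f(1)] f(2), where 'n='n]
      unfolding F_def by eventually_elim auto
    fix t :: real
    define k where "k w = f w + of_real t * h w" for w
    have k: "radial_profile k" "k 0 = 1" unfolding k_def
      using f h by (auto intro!: radial_profile_add radial_profile_cmult)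
    have kFH: "radial k = (\<lambda>x :: real ^ 'n. F x + t *\<^sub>R H x)"
      by (auto simp: radial_def k_def F_def Hh scaleR_conv_of_real)
    have "integrable lborel (radial k :: real ^ 'n \<Rightarrow> complex)"
      unfolding kFH using f(3) H by auto
    hence "(radial k :: real ^ 'n \<Rightarrow> complex) \<in> nikolskii_admissible"
      using radial_profile_in_PW[OF k(1), where 'n='n] k(2)
      unfolding nikolskii_admissible_def radial_def[abs_def] by auto
    hence "L1_norm F \<le> L1_norm (radial k :: real ^ 'n \<Rightarrow> complex)"
      using f(4) unfolding nikolskii_extremal_def by blast
    thus "(LINT x|lborel. norm (F x)) \<le> (LINT x|lborel. norm (F x + t *\<^sub>R H x))"
      by (simp add: L1_norm_def kFH)
  qed
  moreover have "sgn (F x) \<bullet> H x = sgn (F x) \<bullet> G x - Re (g 0) * norm (F x)" for x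
    unfolding H_def inner_add_right inner_sgn_mult by simp
  moreover have "integrable lborel (\<lambda>x. sgn (F x) \<bullet> G x)"
  proof (rule Bochner_Integration.integrable_bound[OF integrable_norm[OF g(2)]])
    have [measurable]: "F \<in> borel_measurable borel" "G \<in> borel_measurable borel"
      unfolding F_def G_def using f(1) g(1) by (auto intro!: radial_measurable radial_profile_holomorphic)
    show "(\<lambda>x. sgn (F x) \<bullet> G x) \<in> borel_measurable lborel"
      unfolding sgn_div_norm by measurable
    show "AE x in lborel. norm (sgn (F x) \<bullet> G x) \<le> norm (norm (radial g x))"
    proof (rule AE_I2)
      fix x
      have "norm (sgn (F x) \<bullet> G x) \<le> norm (sgn (F x)) * norm (G x)"
        using Cauchy_Schwarz_ineq2 by simp
      also have "\<dots> \<le> 1 * norm (G x)" by (intro mult_right_mono) (auto simp: norm_sgn)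
      finally show "norm (sgn (F x) \<bullet> G x) \<le> norm (norm (radial g x))" by (simp add: G_def)
    qed
  qed
  ultimately show ?thesis using f(3) by (simp add: L1_norm_def F_def G_def)
qed

lemma extremal_L1_norm_pos:
  assumes ext: "extremal_profile TYPE('n::finite) f"
  shows "0 < L1_norm (radial f :: real ^ 'n \<Rightarrow> complex)"
proof -
  have f: "radial_profile f" "f 0 = 1" "integrable lborel (radial f :: real ^ 'n \<Rightarrow> complex)"
    using ext by (auto simp: extremal_profile_def)
  have "L1_norm (radial f :: real ^ 'n \<Rightarrow> complex) \<noteq> 0"
  proof
    assume "L1_norm (radial f :: real ^ 'n \<Rightarrow> complex) = 0"
    hence "AE x :: real ^ 'n in lborel. norm (radial f x) = 0"
      unfolding L1_norm_def using f(3) by (subst (asm) integral_nonneg_eq_0_iff_AE) auto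
    hence "AE x :: real ^ 'n in lborel. False"
      using AE_radial_nonzero[OF radial_profile_holomorphic[OF f(1)] f(2), where 'n='n]
      by eventually_elim auto
    thus False by (simp add: not_AE_lborel_False)
  qed
  moreover have "0 \<le> L1_norm (radial f :: real ^ 'n \<Rightarrow> complex)"
    unfolding L1_norm_def by (rule integral_nonneg_AE) simp
  ultimately show ?thesis by simp
qed

text \<open>
  The values \<open>x / (x - a)\<close>, for positive \<open>x\<close>, lie in an open half-plane bounded by a line through the origin: for real
  negative \<open>a\<close> they are positive, and otherwise \<open>Im (1 / (x - a))\<close> has the sign of \<open>Im a\<close>. The factor
  \<open>c\<close> rotates that half-plane to the right one.
\<close>

lemma half_plane_multiplier:
  fixes a :: complex
  assumes a: "a \<notin> {z. Im z = 0 \<and> 0 \<le> Re z}"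
  obtains c K where "\<And>x. 0 < x \<Longrightarrow> 0 < Re (c * of_real x / (of_real x - a))"
    "\<And>x. 0 \<le> x \<Longrightarrow> norm (c * of_real x / (of_real x - a)) \<le> K"
proof -
  define c where "c = (if Im a = 0 then 1 else - \<i> * of_real (sgn (Im a)))"
  define m where "m = (if Im a = 0 then - Re a else \<bar>Im a\<bar>)"
  have m: "m > 0" using a by (auto simp: m_def)
  have nc: "norm c = 1" by (auto simp: c_def norm_mult abs_sgn_eq)
  have dist: "m \<le> norm (of_real x - a)" if "0 \<le> x" for x
  proof (cases "Im a = 0")
    case True
    have "m \<le> Re (of_real x - a)" using that True by (simp add: m_def)
    thus ?thesis using complex_Re_le_cmod order_trans by blast
  next
    case False
    thus ?thesis using abs_Im_le_cmod[of "of_real x - a"] by (simp add: m_def)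
  qed
  have "0 < Re (c * of_real x / (of_real x - a))" if x: "0 < x" for x
  proof -
    have n: "norm (of_real x - a) > 0" using dist[of x] m x by linarith
    have "c * of_real x / (of_real x - a) =
        of_real (x / (norm (of_real x - a))\<^sup>2) * (c * cnj (of_real x - a))"
      using n by (simp add: complex_div_cnj[of _ "of_real x - a"])
    moreover have "0 < Re (c * cnj (of_real x - a))"
      using a x by (auto simp: c_def sgn_if)
    moreover have "Re (of_real r * z) = r * Re z" for r z by simp
    moreover have "0 < x / (norm (of_real x - a))\<^sup>2" using n x by simp
    ultimately show ?thesis by (metis mult_pos_pos)
  qed
  moreover have "norm (c * of_real x / (of_real x - a)) \<le> 1 + norm a / m" if x: "0 \<le> x" for x
  proof -
    have "norm (complex_of_real x) \<le> norm (of_real x - a) + norm a"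
      using norm_triangle_ineq[of "of_real x - a" a] by simp
    also have "\<dots> \<le> norm (of_real x - a) + norm a / m * norm (of_real x - a)"
      using dist[OF x] m mult_left_mono[OF dist[OF x], of "norm a / m"] by simp
    finally have "norm (complex_of_real x) \<le> (1 + norm a / m) * norm (of_real x - a)"
      by (simp add: distrib_right)
    moreover have "0 < norm (of_real x - a)" using dist[OF x] m by linarith
    ultimately show ?thesis by (simp add: norm_divide norm_mult nc pos_divide_le_eq del: zero_less_norm_iff)
  qed
  ultimately show ?thesis using that by blast
qed

text \<open>
  A zero \<open>a\<close> off the positive half-line could be moved: the admissible function
  \<open>c * w * f w / (w - a)\<close> vanishes at 0, while its pairing with the sign of \<open>f\<close> is the integral of a
  function that is positive almost everywhere, against the extremality condition.
\<close>

lemma extremal_zeros_positive: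
  assumes ext: "extremal_profile TYPE('n::finite) f" and fa: "f a = 0"
  shows "Im a = 0 \<and> 0 < Re a"
proof (rule ccontr)
  assume na: "\<not> ?thesis"
  have f: "radial_profile f" "f 0 = 1" "integrable lborel (radial f :: real ^ 'n \<Rightarrow> complex)"
    using ext by (auto simp: extremal_profile_def)
  note hol = radial_profile_holomorphic[OF f(1)]
  have "a \<noteq> 0" using fa f(2) by auto
  hence a: "a \<notin> {z. Im z = 0 \<and> 0 \<le> Re z}" using na by (auto simp: complex_eq_iff)
  obtain c K where c: "\<And>x. 0 < x \<Longrightarrow> 0 < Re (c * of_real x / (of_real x - a))"
    "\<And>x. 0 \<le> x \<Longrightarrow> norm (c * of_real x / (of_real x - a)) \<le> K"
    using half_plane_multiplier[OF a] by metis
  obtain g where g: "g holomorphic_on UNIV" "\<And>w. f w = (w - a) * g w"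
    using entire_divide_linear[OF hol fa] by metis
  define h where "h w = c * (w * g w)" for w
  have h: "radial_profile h" unfolding h_def
    by (intro radial_profile_cmult radial_profile_times_id radial_profile_divide[OF f(1) g])
  define u where "u x = c * of_real (x\<^sup>2) / (of_real (x\<^sup>2) - a)" for x :: real
  have hu: "radial h x = u (norm x) * radial f x" for x :: "real ^ 'n"
  proof -
    have "of_real ((norm x)\<^sup>2) \<noteq> a" using a by auto
    thus ?thesis by (simp add: radial_def h_def u_def g(2))
  qed
  have hint: "integrable lborel (radial h :: real ^ 'n \<Rightarrow> complex)"
  proof (rule Bochner_Integration.integrable_bound)
    show "integrable lborel (\<lambda>x :: real ^ 'n. K * norm (radial f x))" using f(3) by simp
    show "(radial h :: real ^ 'n \<Rightarrow> complex) \<in> borel_measurable lborel"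
      using radial_measurable[OF radial_profile_holomorphic[OF h]] by simp
    show "AE x :: real ^ 'n in lborel. norm (radial h x) \<le> norm (K * norm (radial f x))"
    proof (rule AE_I2)
      fix x :: "real ^ 'n"
      have "norm (u (norm x)) \<le> \<bar>K\<bar>" using c(2)[of "(norm x)\<^sup>2"] by (simp add: u_def)
      thus "norm (radial h x) \<le> norm (K * norm (radial f x))"
        unfolding hu by (simp add: norm_mult abs_mult mult_right_mono)
    qed
  qed
  have eq: "sgn (radial f x) \<bullet> radial h x = Re (u (norm x)) * norm (radial f x)" for x :: "real ^ 'n"
    unfolding hu by (rule inner_sgn_mult)
  have "(LINT x :: real ^ 'n|lborel. Re (u (norm x)) * norm (radial f x)) = 0"
    using extremal_orthogonality[OF ext h hint] unfolding eq by (simp add: h_def)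
  moreover have "integrable lborel (\<lambda>x :: real ^ 'n. Re (u (norm x)) * norm (radial f x))"
  proof (rule Bochner_Integration.integrable_bound[OF integrable_norm[OF hint]])
    have "(\<lambda>x :: real ^ 'n. sgn (radial f x) \<bullet> radial h x) \<in> borel_measurable borel"
      using radial_measurable[OF hol] radial_measurable[OF radial_profile_holomorphic[OF h]]
      unfolding sgn_div_norm by measurable
    thus "(\<lambda>x :: real ^ 'n. Re (u (norm x)) * norm (radial f x)) \<in> borel_measurable lborel"
      unfolding eq by simp
    show "AE x :: real ^ 'n in lborel. norm (Re (u (norm x)) * norm (radial f x)) \<le> norm (norm (radial h x))"
      unfolding hu by (auto simp: norm_mult abs_mult intro!: mult_right_mono abs_Re_le_cmod)
  qed
  moreover have "AE x :: real ^ 'n in lborel. 0 \<le> Re (u (norm x)) * norm (radial f x)"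
  proof (rule AE_I2)
    fix x :: "real ^ 'n"
    show "0 \<le> Re (u (norm x)) * norm (radial f x)"
      using c(1)[of "(norm x)\<^sup>2"] by (cases "x = 0") (auto simp: u_def intro!: mult_nonneg_nonneg)
  qed
  ultimately have "AE x :: real ^ 'n in lborel. Re (u (norm x)) * norm (radial f x) = 0"
    by (subst (asm) integral_nonneg_eq_0_iff_AE) auto
  moreover note AE_radial_nonzero[OF hol f(2), where 'n='n]
  ultimately have "AE x :: real ^ 'n in lborel. False"
  proof eventually_elim
    case (elim x)
    thus ?case using c(1)[of "(norm x)\<^sup>2"] by (auto simp: u_def)
  qed
  thus False by (simp add: not_AE_lborel_False)
qed

section \<open>A quadrature identity at a zero\<close>

text \<open>
  Off the finitely many zeros, \<open>sgn \<Phi> \<bullet> \<Phi>'\<close> is the derivative of the modulus of \<open>\<Phi>\<close>.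
\<close>

lemma has_integral_sgn_deriv:
  fixes \<Phi> :: "complex \<Rightarrow> complex"
  assumes hol: "\<Phi> holomorphic_on UNIV" and ab: "a \<le> b"
    and fin: "finite {r \<in> {a..b}. \<Phi> (of_real r) = 0}"
  shows "((\<lambda>r. sgn (\<Phi> (of_real r)) \<bullet> deriv \<Phi> (of_real r)) has_integral
     (norm (\<Phi> (of_real b)) - norm (\<Phi> (of_real a)))) {a..b}"
proof (rule fundamental_theorem_of_calculus_interior_strong[OF fin ab])
  have der: "((\<lambda>r. \<Phi> (of_real r)) has_vector_derivative deriv \<Phi> (of_real r)) (at r)" for r
    by (rule has_vector_derivative_real_field) (use hol in \<open>auto intro: holomorphic_derivI\<close>)
  show "continuous_on {a..b} (\<lambda>r. norm (\<Phi> (of_real r)))"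
    by (intro continuous_on_norm continuous_at_imp_continuous_on ballI has_vector_derivative_continuous[OF der])
  fix r assume "r \<in> {a<..<b} - {r \<in> {a..b}. \<Phi> (of_real r) = 0}"
  hence nz: "\<Phi> (of_real r) \<noteq> 0" by auto
  have "((\<lambda>r. norm (\<Phi> (of_real r))) has_derivative
      (\<lambda>s. sgn (\<Phi> (of_real r)) \<bullet> (s *\<^sub>R deriv \<Phi> (of_real r)))) (at r)"
    using has_derivative_compose[OF der[of r, unfolded has_vector_derivative_def] has_derivative_norm[OF nz]]
    by (simp add: inner_commute)
  thus "((\<lambda>r. norm (\<Phi> (of_real r))) has_vector_derivative
      sgn (\<Phi> (of_real r)) \<bullet> deriv \<Phi> (of_real r)) (at r)"
    by (simp add: has_vector_derivative_def)
qed

lemma radial_profile_power: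
  assumes "radial_profile f"
  shows "radial_profile (\<lambda>w. w ^ n * f w)"
proof (induction n)
  case (Suc n)
  thus ?case using radial_profile_times_id[OF Suc.IH] by (simp add: mult.assoc)
qed (use assms in simp)

text \<open>
  The odd powers of \<open>z\<close> are not powers of \<open>z\<^sup>2\<close>, hence the detour
  \<open>norm z ^ n \<le> 1 + norm z ^ (2 * n)\<close>.
\<close>

lemma line_function_growth:
  assumes "radial_profile f"
  obtains A where "\<And>z. norm (z ^ n * f (z\<^sup>2)) \<le> A * exp (2 * norm z)"
proof -
  obtain A where A: "A \<ge> 0" "\<And>w. norm (f w) \<le> A * exp ((1 + 1) * sqrt (norm w))"
    using radial_profile_growth[OF assms zero_less_one] by blast
  obtain B where B: "B \<ge> 0" "\<And>w. norm (w ^ n * f w) \<le> B * exp ((1 + 1) * sqrt (norm w))"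
    using radial_profile_growth[OF radial_profile_power[OF assms] zero_less_one] by blast
  have "norm (z ^ n * f (z\<^sup>2)) \<le> (A + B) * exp (2 * norm z)" for z
  proof -
    have 1: "norm (f (z\<^sup>2)) \<le> A * exp (2 * norm z)"
      and 2: "norm ((z\<^sup>2) ^ n * f (z\<^sup>2)) \<le> B * exp (2 * norm z)"
      using A(2)[of "z\<^sup>2"] B(2)[of "z\<^sup>2"] by (simp_all add: norm_power)
    have "norm z ^ n \<le> 1 + norm z ^ (2 * n)"
    proof (cases "norm z \<le> 1")
      case True
      hence "norm z ^ n \<le> 1" by (simp add: power_le_one)
      thus ?thesis by (simp add: add_increasing2)
    next
      case False
      hence "norm z ^ n \<le> norm z ^ (2 * n)" by (intro power_increasing) auto
      thus ?thesis by simp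
    qed
    hence "norm (z ^ n * f (z\<^sup>2)) \<le> (1 + norm z ^ (2 * n)) * norm (f (z\<^sup>2))"
      unfolding norm_mult norm_power by (rule mult_right_mono) simp
    also have "\<dots> = norm (f (z\<^sup>2)) + norm ((z\<^sup>2) ^ n * f (z\<^sup>2))"
      by (simp add: norm_mult norm_power distrib_right power_mult)
    also have "\<dots> \<le> (A + B) * exp (2 * norm z)" using 1 2 by (simp add: distrib_right)
    finally show ?thesis .
  qed
  thus ?thesis using that by blast
qed

text \<open>
  Dividing by \<open>1 - r\<^sup>2 / \<tau>\<^sup>2\<close> gains two powers of \<open>r\<close> at infinity, which leaves one to spare
  for the additional factor \<open>r\<close>. Both sides of the line contribute because the modulus is even.
\<close>

lemma integrable_line_function:
  fixes f g :: "complex \<Rightarrow> complex"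
  assumes g: "g holomorphic_on UNIV" and \<tau>: "0 < \<tau>"
    and fg: "\<And>w. f w = (1 - w / of_real (\<tau>\<^sup>2)) * g w"
    and f: "set_integrable lborel {0..} (\<lambda>r. r ^ m *\<^sub>R f ((of_real r)\<^sup>2))"
  shows "integrable lborel (\<lambda>x. (of_real x) ^ Suc m * g ((of_real x)\<^sup>2))"
proof -
  define F where "F x = (of_real x) ^ Suc m * g ((of_real x)\<^sup>2)" for x :: real
  have contg: "continuous_on UNIV g" using g by (rule holomorphic_on_imp_continuous_on)
  have contF: "continuous_on UNIV F"
    unfolding F_def by (intro continuous_intros continuous_on_compose2[OF contg]) auto
  define u where "u r = indicator {0..} r *\<^sub>R (r ^ m *\<^sub>R f ((of_real r)\<^sup>2))" for r :: real
  have u: "integrable lborel u" using f unfolding set_integrable_def u_def[abs_def] .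
  have u': "integrable lborel (\<lambda>x. u (- x))"
    using lborel_integrable_real_affine[OF u, of "-1" 0] by simp
  have c: "integrable lborel (\<lambda>x. indicator {- (2 * \<tau>)..2 * \<tau>} x *\<^sub>R F x)"
    by (intro borel_integrable_compact continuous_on_subset[OF contF]) auto
  have main: "norm (F x) \<le> \<tau> * norm (u \<bar>x\<bar>)" if x: "2 * \<tau> \<le> \<bar>x\<bar>" for x
  proof -
    define r where "r = \<bar>x\<bar>"
    have r: "2 * \<tau> \<le> r" "0 < r" using x \<tau> by (auto simp: r_def)
    have "4 * \<tau>\<^sup>2 \<le> r\<^sup>2" using power_mono[of "2 * \<tau>" r 2] r \<tau> by (simp add: power_mult_distrib)
    hence q: "3 / 4 * (r\<^sup>2 / \<tau>\<^sup>2) \<le> r\<^sup>2 / \<tau>\<^sup>2 - 1" using \<tau> by (simp add: field_simps)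
    have "norm (1 - complex_of_real (r\<^sup>2 / \<tau>\<^sup>2)) = \<bar>1 - r\<^sup>2 / \<tau>\<^sup>2\<bar>"
      by (metis norm_of_real of_real_1 of_real_diff)
    also have "\<dots> \<ge> 3 / 4 * (r\<^sup>2 / \<tau>\<^sup>2)" using q by linarith
    finally have n1: "3 / 4 * (r\<^sup>2 / \<tau>\<^sup>2) \<le> norm (1 - complex_of_real (r\<^sup>2 / \<tau>\<^sup>2))" .
    have "r \<le> \<tau> * (3 / 4 * (r\<^sup>2 / \<tau>\<^sup>2))"
      using mult_left_mono[OF r(1), of r] r \<tau> by (simp add: field_simps power2_eq_square)
    also have "\<dots> \<le> \<tau> * norm (1 - complex_of_real (r\<^sup>2 / \<tau>\<^sup>2))"
      using n1 \<tau> by (intro mult_left_mono) auto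
    finally have n2: "r \<le> \<tau> * norm (1 - complex_of_real (r\<^sup>2 / \<tau>\<^sup>2))" .
    have x2: "(complex_of_real x)\<^sup>2 = of_real (r\<^sup>2)" by (simp add: r_def flip: of_real_power)
    have "norm (F x) = r * (r ^ m * norm (g (of_real (r\<^sup>2))))"
      unfolding F_def x2 norm_mult norm_power norm_of_real by (simp add: r_def mult.assoc)
    also have "\<dots> \<le> (\<tau> * norm (1 - complex_of_real (r\<^sup>2 / \<tau>\<^sup>2))) * (r ^ m * norm (g (of_real (r\<^sup>2))))"
      using n2 r by (intro mult_right_mono) auto
    also have "\<dots> = \<tau> * norm (u r)"
      using r by (simp add: u_def fg norm_mult norm_power)
    finally show ?thesis by (simp add: r_def)
  qed
  \<comment> \<open>On the compact interval around the zeros of the denominator continuity suffices.\<close>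
  have "integrable lborel F"
  proof (rule Bochner_Integration.integrable_bound)
    show "integrable lborel (\<lambda>x. \<tau> * (norm (u x) + norm (u (- x))) +
        norm (indicator {- (2 * \<tau>)..2 * \<tau>} x *\<^sub>R F x))"
      using u u' c by (intro Bochner_Integration.integrable_add integrable_mult_right integrable_norm) auto
    show "F \<in> borel_measurable lborel" using borel_measurable_continuous_onI[OF contF] by simp
    show "AE x in lborel. norm (F x) \<le> norm (\<tau> * (norm (u x) + norm (u (- x))) +
        norm (indicator {- (2 * \<tau>)..2 * \<tau>} x *\<^sub>R F x))"
    proof (rule AE_I2)
      fix x
      define R where "R = \<tau> * (norm (u x) + norm (u (- x)))"
      have R: "R \<ge> 0" using \<tau> by (simp add: R_def)
      have "norm (F x) \<le> R + norm (indicator {- (2 * \<tau>)..2 * \<tau>} x *\<^sub>R F x)"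
      proof (cases "x \<in> {- (2 * \<tau>)..2 * \<tau>}")
        case True
        thus ?thesis using R by simp
      next
        case False
        hence "norm (F x) \<le> \<tau> * norm (u \<bar>x\<bar>)" using main[of x] by auto
        also have "\<dots> \<le> R" unfolding R_def using \<tau> by (intro mult_left_mono) (auto simp: abs_if)
        finally show ?thesis using False by simp
      qed
      thus "norm (F x) \<le> norm (\<tau> * (norm (u x) + norm (u (- x))) +
          norm (indicator {- (2 * \<tau>)..2 * \<tau>} x *\<^sub>R F x))"
        using R by (simp add: R_def)
    qed
  qed
  thus ?thesis by (simp add: F_def[abs_def])
qed

text \<open>
  The bracket depends on \<open>z\<^sup>2\<close> only, so \<open>\<Phi>'\<close> is the radial density \<open>r ^ m\<close> times
  a function of \<open>r\<^sup>2\<close>. This makes \<open>\<Phi>'\<close> accessible to the extremality condition.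
\<close>

lemma deriv_line_function:
  assumes g: "g holomorphic_on UNIV"
  shows "deriv (\<lambda>z. z ^ Suc m * g (z\<^sup>2)) z =
    z ^ m * (of_nat (Suc m) * g (z\<^sup>2) + 2 * (z\<^sup>2 * deriv g (z\<^sup>2)))"
proof (rule DERIV_imp_deriv)
  have "((\<lambda>z. g (z\<^sup>2)) has_field_derivative deriv g (z\<^sup>2) * (2 * z)) (at z)"
    by (rule DERIV_chain2[OF holomorphic_derivI[OF g]]) (auto intro!: derivative_eq_intros)
  moreover have "((\<lambda>z. z ^ Suc m) has_field_derivative of_nat (Suc m) * z ^ m) (at z)"
    using DERIV_power[OF DERIV_ident, where n = "Suc m"] by simp
  ultimately have "((\<lambda>z. z ^ Suc m * g (z\<^sup>2)) has_field_derivative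
      (of_nat (Suc m) * z ^ m) * g (z\<^sup>2) + deriv g (z\<^sup>2) * (2 * z) * z ^ Suc m) (at z)"
    by (rule DERIV_mult[rotated])
  thus "((\<lambda>z. z ^ Suc m * g (z\<^sup>2)) has_field_derivative
      z ^ m * (of_nat (Suc m) * g (z\<^sup>2) + 2 * (z\<^sup>2 * deriv g (z\<^sup>2)))) (at z)"
    by (simp add: algebra_simps power2_eq_square)
qed

text \<open>
  For positive \<open>r\<close>, the sign of \<open>f\<close> is that of \<open>\<Phi>\<close> before \<open>\<tau>\<close> and its negative after \<open>\<tau>\<close>. The integral is
  therefore the increase of the modulus of \<open>\<Phi>\<close> from 0 to \<open>\<tau>\<close> minus its increase from \<open>\<tau>\<close> to \<open>T\<close>,
  and \<open>\<Phi>\<close> vanishes at both 0 and \<open>T\<close>.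
\<close>

lemma integral_sgn_deriv_line_function:
  fixes f g :: "complex \<Rightarrow> complex" and m :: nat
  assumes f: "f holomorphic_on UNIV" "f 0 = 1" and g: "g holomorphic_on UNIV" and \<tau>: "0 < \<tau>"
    and fg: "\<And>w. f w = (1 - w / of_real (\<tau>\<^sup>2)) * g w"
    and T: "\<tau> < T" "f ((of_real T)\<^sup>2) = 0"
  defines "\<Phi> \<equiv> \<lambda>z. z ^ Suc m * g (z\<^sup>2)"
  shows "((\<lambda>r. sgn (f ((of_real r)\<^sup>2)) \<bullet> deriv \<Phi> (of_real r)) has_integral
    2 * (\<tau> ^ Suc m * norm (g (of_real (\<tau>\<^sup>2))))) {0..T}"
proof -
  have hol\<Phi>: "\<Phi> holomorphic_on UNIV"
    unfolding \<Phi>_def by (intro holomorphic_intros holomorphic_on_compose_gen[OF _ g, unfolded o_def]) auto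
  have g0: "g 0 = 1" using fg[of 0] f by simp
  have fin: "finite {r \<in> {a..b}. \<Phi> (of_real r) = 0}" if "0 \<le> a" for a b
  proof -
    have "finite ((\<lambda>z. sqrt (Re z)) ` {z \<in> cball 0 (b\<^sup>2). g z = 0})"
      by (intro finite_imageI finite_zeros_in_cball g g0)
    moreover have "{r \<in> {a..b}. \<Phi> (of_real r) = 0} \<subseteq>
        insert 0 ((\<lambda>z. sqrt (Re z)) ` {z \<in> cball 0 (b\<^sup>2). g z = 0})"
    proof
      fix r assume r: "r \<in> {r \<in> {a..b}. \<Phi> (of_real r) = 0}"
      show "r \<in> insert 0 ((\<lambda>z. sqrt (Re z)) ` {z \<in> cball 0 (b\<^sup>2). g z = 0})"
      proof (cases "r = 0")
        case False
        hence "g (of_real (r\<^sup>2)) = 0" using r by (simp add: \<Phi>_def)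
        moreover have "r\<^sup>2 \<le> b\<^sup>2" using r that by (intro power_mono) auto
        moreover have "r = sqrt (Re (of_real (r\<^sup>2)))" using r that by simp
        ultimately show ?thesis by (intro insertI2 image_eqI[of _ _ "of_real (r\<^sup>2)"]) (auto simp del: of_real_power)
      qed simp
    qed
    ultimately show ?thesis using finite_subset by blast
  qed
  have sgnf: "sgn (f ((of_real r)\<^sup>2)) = of_real (sgn (1 - r\<^sup>2 / \<tau>\<^sup>2)) * sgn (\<Phi> (of_real r))" if "0 < r" for r
  proof -
    have "of_real (r ^ Suc m) * f ((of_real r)\<^sup>2) = of_real (1 - r\<^sup>2 / \<tau>\<^sup>2) * \<Phi> (of_real r)"
      by (simp add: fg \<Phi>_def)
    hence "sgn (complex_of_real (r ^ Suc m)) * sgn (f ((of_real r)\<^sup>2)) =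
        sgn (complex_of_real (1 - r\<^sup>2 / \<tau>\<^sup>2)) * sgn (\<Phi> (of_real r))" by (metis sgn_mult)
    moreover have "sgn (r ^ Suc m) = 1" using that by simp
    ultimately show ?thesis by (simp only: sgn_of_real of_real_1 mult_1)
  qed
  have \<Phi>\<tau>: "norm (\<Phi> (of_real \<tau>)) = \<tau> ^ Suc m * norm (g (of_real (\<tau>\<^sup>2)))"
    using \<tau> by (simp add: \<Phi>_def norm_mult norm_power)
  have \<Phi>0: "\<Phi> (of_real 0) = 0" by (simp add: \<Phi>_def)
  have \<Phi>T: "\<Phi> (of_real T) = 0"
  proof -
    have "1 - T\<^sup>2 / \<tau>\<^sup>2 \<noteq> 0" using T(1) \<tau> by (simp add: field_simps power2_eq_iff)
    hence "1 - (of_real T)\<^sup>2 / complex_of_real (\<tau>\<^sup>2) \<noteq> 0"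
      by (metis of_real_1 of_real_diff of_real_divide of_real_eq_0_iff of_real_power)
    hence "g ((of_real T)\<^sup>2) = 0" using T(2) fg[of "(of_real T)\<^sup>2"] by (metis mult_eq_0_iff)
    thus ?thesis by (simp add: \<Phi>_def)
  qed
  have "((\<lambda>r. sgn (f ((of_real r)\<^sup>2)) \<bullet> deriv \<Phi> (of_real r)) has_integral norm (\<Phi> (of_real \<tau>)) - norm (\<Phi> (of_real 0))) {0..\<tau>}"
  proof (rule has_integral_spike_finite[OF _ _ has_integral_sgn_deriv[OF hol\<Phi>]])
    show "finite {0, \<tau>}" by simp
    show "sgn (f ((of_real r)\<^sup>2)) \<bullet> deriv \<Phi> (of_real r) = sgn (\<Phi> (of_real r)) \<bullet> deriv \<Phi> (of_real r)"
      if "r \<in> {0..\<tau>} - {0, \<tau>}" for r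
    proof -
      have "r\<^sup>2 < \<tau>\<^sup>2" using that by (intro power_strict_mono) auto
      hence "sgn (1 - r\<^sup>2 / \<tau>\<^sup>2) = 1" using \<tau> by simp
      thus ?thesis using sgnf[of r] that by simp
    qed
  qed (use \<tau> fin in auto)
  moreover have "((\<lambda>r. sgn (f ((of_real r)\<^sup>2)) \<bullet> deriv \<Phi> (of_real r)) has_integral
      - (norm (\<Phi> (of_real T)) - norm (\<Phi> (of_real \<tau>)))) {\<tau>..T}"
  proof (rule has_integral_spike_finite[OF _ _ has_integral_neg[OF has_integral_sgn_deriv[OF hol\<Phi>]]])
    show "finite {\<tau>}" by simp
    show "sgn (f ((of_real r)\<^sup>2)) \<bullet> deriv \<Phi> (of_real r) = - (sgn (\<Phi> (of_real r)) \<bullet> deriv \<Phi> (of_real r))"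
      if "r \<in> {\<tau>..T} - {\<tau>}" for r
    proof -
      have "\<tau>\<^sup>2 < r\<^sup>2" using that \<tau> by (intro power_strict_mono) auto
      hence "sgn (1 - r\<^sup>2 / \<tau>\<^sup>2) = -1" using \<tau> by simp
      thus ?thesis using sgnf[of r] that \<tau> by simp
    qed
  qed (use T \<tau> fin in auto)
  ultimately have "((\<lambda>r. sgn (f ((of_real r)\<^sup>2)) \<bullet> deriv \<Phi> (of_real r)) has_integral
      (norm (\<Phi> (of_real \<tau>)) - norm (\<Phi> (of_real 0))) + - (norm (\<Phi> (of_real T)) - norm (\<Phi> (of_real \<tau>)))) {0..T}"
    using \<tau> T by (intro has_integral_combine[where c = \<tau>]) auto
  thus ?thesis unfolding \<Phi>0 \<Phi>T \<Phi>\<tau> by (simp add: mult.assoc)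
qed

text \<open>
  The extremality condition for \<open>G\<close>, the profile with \<open>\<Phi>' r = r ^ (CARD('n) - 1) * G (r\<^sup>2)\<close> and
  \<open>\<Phi> r = r ^ CARD('n) * g (r\<^sup>2)\<close>. Its value at 0 is \<open>CARD('n)\<close>, which cancels the dimension in the
  surface area of the sphere. The integral over the half-line is the limit along zeros \<open>T\<close> of \<open>f\<close>.
\<close>

lemma extremal_quadrature:
  fixes f g :: "complex \<Rightarrow> complex"
  assumes ext: "extremal_profile TYPE('n::finite) f"
    and g: "g holomorphic_on UNIV" and \<tau>: "0 < \<tau>"
    and fg: "\<And>w. f w = (1 - w / of_real (\<tau>\<^sup>2)) * g w"
    and unbounded: "\<And>r. \<exists>T>r. f ((of_real T)\<^sup>2) = 0"
  shows "L1_norm (radial f :: real ^ 'n \<Rightarrow> complex) =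
    2 * measure lborel (ball (0 :: real ^ 'n) 1) * (\<tau> ^ CARD('n) * norm (g (of_real (\<tau>\<^sup>2))))"
proof -
  have f: "radial_profile f" "f 0 = 1" "integrable lborel (radial f :: real ^ 'n \<Rightarrow> complex)"
    using ext by (auto simp: extremal_profile_def)
  note hol = radial_profile_holomorphic[OF f(1)]
  obtain m where m: "CARD('n) = Suc m" using not0_implies_Suc[of "CARD('n)"] by auto
  have dim: "DIM(real ^ 'n) = Suc m" by (simp add: m)
  define V where "V = measure lborel (ball (0 :: real ^ 'n) 1)"
  have V: "V > 0" unfolding V_def by (simp add: content_ball_pos)
  have g0: "g 0 = 1" using fg[of 0] f by simp
  have prof_g: "radial_profile g"
  proof (rule radial_profile_divide[OF radial_profile_cmult[OF f(1), of "- of_real (\<tau>\<^sup>2)"] g])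
    show "- of_real (\<tau>\<^sup>2) * f w = (w - of_real (\<tau>\<^sup>2)) * g w" for w
      using \<tau> by (simp add: fg field_simps)
  qed
  define \<Phi> where "\<Phi> = (\<lambda>z. z ^ Suc m * g (z\<^sup>2))"
  have hol\<Phi>: "\<Phi> holomorphic_on UNIV"
    unfolding \<Phi>_def by (intro holomorphic_intros holomorphic_on_compose_gen[OF _ g, unfolded o_def]) auto
  have measr: "(\<lambda>r. h ((complex_of_real r)\<^sup>2)) \<in> borel_measurable borel" if "h holomorphic_on UNIV" for h
    by (intro borel_measurable_continuous_onI continuous_on_compose2[OF holomorphic_on_imp_continuous_on[OF that]]
        continuous_intros) auto
  have "set_integrable lborel {0..} (\<lambda>r. r ^ m *\<^sub>R f ((of_real r)\<^sup>2))"
    using integrable_radial[OF measr[OF hol], where 'a = "real ^ 'n"] f(3)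
    by (simp add: radial_def[abs_def] m)
  hence int\<Phi>: "integrable lborel (\<lambda>x. \<Phi> (of_real x))"
    unfolding \<Phi>_def by (intro integrable_line_function[OF g \<tau> fg])
  obtain A where A: "\<And>z. norm (\<Phi> z) \<le> A * exp (2 * norm z)"
    using line_function_growth[OF prof_g, of "Suc m"] unfolding \<Phi>_def by metis
  have int\<Phi>': "integrable lborel (\<lambda>x. deriv \<Phi> (of_real x))"
    by (rule integrable_deriv_exp_type[OF hol\<Phi> _ A int\<Phi>]) simp
  define G where "G w = of_nat (Suc m) * g w + 2 * (w * deriv g w)" for w
  have prof_G: "radial_profile G"
    unfolding G_def
    by (intro radial_profile_add radial_profile_cmult radial_profile_times_id radial_profile_deriv prof_g)
  have \<Phi>G: "deriv \<Phi> (of_real r) = r ^ m *\<^sub>R G ((of_real r)\<^sup>2)" for r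
    unfolding \<Phi>_def deriv_line_function[OF g] G_def by (simp add: scaleR_conv_of_real)
  have "set_integrable lborel {0..} (\<lambda>r. r ^ m *\<^sub>R G ((of_real r)\<^sup>2))"
    unfolding set_integrable_def \<Phi>G[symmetric] by (rule integrable_mult_indicator[OF _ int\<Phi>']) simp
  hence intG: "integrable lborel (radial G :: real ^ 'n \<Rightarrow> complex)"
    using integrable_radial[OF measr[OF radial_profile_holomorphic[OF prof_G]], where 'a = "real ^ 'n"]
    by (simp add: radial_def[abs_def] m)
  define p where "p r = sgn (f ((of_real r)\<^sup>2)) \<bullet> G ((of_real r)\<^sup>2)" for r :: real
  have p_meas: "p \<in> borel_measurable borel"
    using measr[OF hol] measr[OF radial_profile_holomorphic[OF prof_G]]
    unfolding p_def sgn_div_norm by measurable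
  define q where "q r = sgn (f ((of_real r)\<^sup>2)) \<bullet> deriv \<Phi> (of_real r)" for r :: real
  have qp: "q r = r ^ m *\<^sub>R p r" for r unfolding q_def p_def \<Phi>G by simp
  have "Re (G 0) * L1_norm (radial f :: real ^ 'n \<Rightarrow> complex) = (LINT x :: real ^ 'n|lborel. p (norm x))"
    using extremal_orthogonality[OF ext prof_G intG] by (simp add: p_def radial_def)
  also have "\<dots> = Suc m * V * (LINT r:{0..}|lborel. q r)"
    using integral_radial[OF p_meas, where 'a = "real ^ 'n"] by (simp add: m V_def qp)
  finally have 1: "Suc m * L1_norm (radial f :: real ^ 'n \<Rightarrow> complex) = Suc m * (V * (LINT r:{0..}|lborel. q r))"
    by (simp add: G_def g0)
  hence 1: "L1_norm (radial f :: real ^ 'n \<Rightarrow> complex) = V * (LINT r:{0..}|lborel. q r)"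
    by (simp only: mult_cancel_left of_nat_eq_0_iff) simp
  define L where "L = 2 * (\<tau> ^ Suc m * norm (g (of_real (\<tau>\<^sup>2))))"
  have intq: "integrable lborel (\<lambda>r. indicator {0..} r *\<^sub>R q r)"
  proof (rule Bochner_Integration.integrable_bound[OF integrable_norm[OF int\<Phi>']])
    have "q \<in> borel_measurable borel" unfolding qp[abs_def] using p_meas by measurable
    thus "(\<lambda>r. indicator {0..} r *\<^sub>R q r) \<in> borel_measurable lborel" by measurable
    show "AE r in lborel. norm (indicator {0..} r *\<^sub>R q r) \<le> norm (norm (deriv \<Phi> (of_real r)))"
    proof (rule AE_I2)
      fix r :: real
      have "norm (indicator {0..} r *\<^sub>R q r) \<le> \<bar>q r\<bar>" by (simp add: indicator_def)
      also have "\<dots> \<le> norm (sgn (f ((of_real r)\<^sup>2))) * norm (deriv \<Phi> (of_real r))"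
        unfolding q_def by (rule Cauchy_Schwarz_ineq2)
      also have "\<dots> \<le> 1 * norm (deriv \<Phi> (of_real r))" by (intro mult_right_mono) (auto simp: norm_sgn)
      finally show "norm (indicator {0..} r *\<^sub>R q r) \<le> norm (norm (deriv \<Phi> (of_real r)))" by simp
    qed
  qed
  have lim: "((\<lambda>T. LINT r|lborel. indicator {..T} r *\<^sub>R (indicator {0..} r *\<^sub>R q r)) \<longlongrightarrow>
      (LINT r:{0..}|lborel. q r)) at_top"
    unfolding set_lebesgue_integral_def by (rule tendsto_integral_at_top[OF _ intq]) simp
  have val: "(LINT r|lborel. indicator {..T} r *\<^sub>R (indicator {0..} r *\<^sub>R q r)) = L"
    if T: "\<tau> < T" "f ((of_real T)\<^sup>2) = 0" for T
  proof -
    have e: "indicator {..T} r *\<^sub>R (indicator {0..} r *\<^sub>R q r) = indicator {0..T} r *\<^sub>R q r" for r :: real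
      by (auto simp: indicator_def)
    have s: "set_integrable lborel {0..T} q"
      unfolding set_integrable_def e[symmetric] by (rule integrable_mult_indicator[OF _ intq]) simp
    have "(LINT r|lborel. indicator {..T} r *\<^sub>R (indicator {0..} r *\<^sub>R q r)) = (LINT r:{0..T}|lborel. q r)"
      unfolding e set_lebesgue_integral_def by simp
    also have "\<dots> = integral {0..T} q" by (rule set_borel_integral_eq_integral(2)[OF s])
    also have "\<dots> = L"
      unfolding q_def[abs_def] L_def \<Phi>_def
      by (intro integral_unique integral_sgn_deriv_line_function hol f(2) g \<tau> fg T)
    finally show ?thesis .
  qed
  have "(LINT r:{0..}|lborel. q r) = L"
  proof (rule ccontr)
    assume "(LINT r:{0..}|lborel. q r) \<noteq> L"
    from tendsto_imp_eventually_ne[OF lim this] obtain T0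
      where T0: "\<And>T. T0 \<le> T \<Longrightarrow> (LINT r|lborel. indicator {..T} r *\<^sub>R (indicator {0..} r *\<^sub>R q r)) \<noteq> L"
      unfolding eventually_at_top_linorder by blast
    obtain T where "max T0 \<tau> < T" "f ((of_real T)\<^sup>2) = 0" using unbounded by blast
    thus False using T0[of T] val[of T] by simp
  qed
  thus ?thesis by (simp add: 1 L_def V_def m)
qed

section \<open>The product formula\<close>

lemma a_const_eq_L1_norm:
  assumes "nikolskii_extremal (f :: real ^ 'n::finite \<Rightarrow> complex)"
  shows "a_const TYPE('n) = L1_norm f / (2 * measure lborel (ball (0 :: real ^ 'n) 1))"
proof -
  have "(INF g \<in> (nikolskii_admissible :: (real ^ 'n \<Rightarrow> complex) set). L1_norm g) = L1_norm f"
    using assms unfolding nikolskii_extremal_def by (intro cInf_eq_minimum) auto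
  thus ?thesis by (simp add: a_const_def nikolskii_const_def inverse_eq_divide)
qed

lemma entire_divide_zero:
  fixes f :: "complex \<Rightarrow> complex"
  assumes "f holomorphic_on UNIV" "f a = 0" "a \<noteq> 0"
  obtains g where "g holomorphic_on UNIV" "\<And>w. f w = (1 - w / a) * g w"
proof -
  have "\<exists>g. g holomorphic_on UNIV \<and> (\<forall>w. f w = (\<Prod>b\<in>{a}. 1 - w / b) * g w)"
    by (rule entire_divide_zeros) (use assms in auto)
  thus ?thesis using that by auto
qed

lemma deriv_at_divided_zero:
  fixes f g :: "complex \<Rightarrow> complex"
  assumes "g holomorphic_on UNIV" "\<And>w. f w = (1 - w / a) * g w"
  shows "deriv f w = (1 - w / a) * deriv g w - g w / a"
proof (rule DERIV_imp_deriv)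
  have "((\<lambda>w. 1 - w / a) has_field_derivative 0 - 1 / a) (at w)"
    by (intro DERIV_diff DERIV_const DERIV_cdivide DERIV_ident)
  moreover have "(g has_field_derivative deriv g w) (at w)"
    by (rule holomorphic_derivI[OF assms(1)]) auto
  ultimately have "((\<lambda>w. (1 - w / a) * g w) has_field_derivative
      (0 - 1 / a) * g w + deriv g w * (1 - w / a)) (at w)"
    by (rule DERIV_mult)
  hence "((\<lambda>w. (1 - w / a) * g w) has_field_derivative (1 - w / a) * deriv g w - g w / a) (at w)"
    by (simp add: algebra_simps)
  thus "(f has_field_derivative (1 - w / a) * deriv g w - g w / a) (at w)"
    using assms(2) by presburger
qed

(* The zeros are numbered from 0: tau k here is the (k+1)-st positive zero. *)
theorem mainTheorem6:
  fixes \<phi> :: "complex \<Rightarrow> complex" and \<tau> :: "nat \<Rightarrow> real" and k :: nat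
  assumes entire: "\<phi> holomorphic_on UNIV"
    and even_fun: "\<And>z. \<phi> (- z) = \<phi> z"
    and extremal: "nikolskii_extremal (\<lambda>x :: real ^ 'n::finite. \<phi> (complex_of_real (norm x)))"
    and zeros_increasing: "strict_mono \<tau>"
    and zeros: "range \<tau> = {x. 0 < x \<and> \<phi> (complex_of_real x) = 0}"
  shows "convergent_prod (\<lambda>j. if j = k then 1 else \<bar>1 - (\<tau> k)\<^sup>2 / (\<tau> j)\<^sup>2\<bar>)
    \<and> a_const TYPE('n) =
        \<tau> k ^ CARD('n) * (\<Prod>j. if j = k then 1 else \<bar>1 - (\<tau> k)\<^sup>2 / (\<tau> j)\<^sup>2\<bar>)"
proof -
  have adm: "(\<lambda>x :: real ^ 'n. \<phi> (complex_of_real (norm x))) \<in> nikolskii_admissible"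
    using extremal by (simp add: nikolskii_extremal_def)
  obtain f where f: "radial_profile f" "\<And>z. \<phi> z = f (z\<^sup>2)"
    "integrable lborel (\<lambda>x :: real ^ 'n. f ((of_real (norm x))\<^sup>2))"
    using radial_PW_profile[OF entire even_fun] adm unfolding nikolskii_admissible_def by blast
  note hol = radial_profile_holomorphic[OF f(1)]
  have f0: "f 0 = 1" using adm f(2)[of 0] by (simp add: nikolskii_admissible_def)
  have rad: "radial f = (\<lambda>x :: real ^ 'n. \<phi> (complex_of_real (norm x)))"
    by (simp add: radial_def[abs_def] f(2))
  have ext: "extremal_profile TYPE('n) f"
    using f f0 extremal unfolding extremal_profile_def rad by (simp add: f(2))
  define V where "V = measure lborel (ball (0 :: real ^ 'n) 1)"
  have V: "V > 0" unfolding V_def by (simp add: content_ball_pos)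
  have \<tau>pos: "\<tau> j > 0" for j using zeros by auto
  define a where "a j = complex_of_real ((\<tau> j)\<^sup>2)" for j
  have inj_a: "inj a"
  proof (rule injI)
    fix i j assume "a i = a j"
    hence "(\<tau> i)\<^sup>2 = (\<tau> j)\<^sup>2" unfolding a_def of_real_eq_iff .
    hence "\<tau> i = \<tau> j" using \<tau>pos by (simp add: power2_eq_iff_nonneg less_imp_le)
    thus "i = j" using zeros_increasing strict_mono_eq by blast
  qed
  have fa: "f (a j) = 0" for j
  proof -
    have "\<phi> (of_real (\<tau> j)) = 0" using zeros by auto
    thus ?thesis by (simp add: f(2) a_def)
  qed
  have zero_imp: "\<exists>j. z = a j" if "f z = 0" for z
  proof -
    have z: "Im z = 0" "0 < Re z" using extremal_zeros_positive[OF ext that] by auto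
    hence zr: "z = (of_real (sqrt (Re z)))\<^sup>2" by (simp add: complex_eq_iff flip: of_real_power)
    hence "\<phi> (of_real (sqrt (Re z))) = 0" using that f(2) by metis
    hence "sqrt (Re z) \<in> range \<tau>" using zeros z by simp
    then obtain j where "\<tau> j = sqrt (Re z)" by auto
    thus ?thesis using zr by (intro exI[of _ j]) (simp add: a_def)
  qed
  have \<tau>_unbounded: "\<exists>j. r < \<tau> j" for r
  proof (rule ccontr)
    assume "\<not> ?thesis"
    hence le: "\<tau> j \<le> r" for j by (meson not_less)
    have "a j \<in> {z \<in> cball 0 (r\<^sup>2). f z = 0}" for j
    proof -
      have "norm (a j) = (\<tau> j)\<^sup>2" unfolding a_def norm_of_real by simp
      also have "\<dots> \<le> r\<^sup>2" using le[of j] \<tau>pos[of j] by (intro power_mono) auto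
      finally show ?thesis using fa by simp
    qed
    hence "finite (a ` UNIV)"
      by (intro finite_subset[OF _ finite_zeros_in_cball[OF hol f0, of "r\<^sup>2"]]) auto
    moreover note inj_a
    ultimately show False using finite_imageD infinite_UNIV_nat by blast
  qed
  have \<tau>_lim: "filterlim (\<lambda>n. (\<tau> (Suc n))\<^sup>2) at_top sequentially"
  proof -
    have "filterlim \<tau> at_top sequentially"
      unfolding filterlim_at_top
    proof
      fix r
      obtain j where "r < \<tau> j" using \<tau>_unbounded by blast
      thus "\<forall>\<^sub>F n in sequentially. r \<le> \<tau> n"
        using strict_mono_less_eq[OF zeros_increasing]
        by (intro eventually_sequentiallyI[of j]) (meson less_imp_le order_trans)
    qed
    hence "filterlim (\<lambda>n. \<tau> (Suc n)) at_top sequentially" by (rule filterlim_compose[OF _ filterlim_Suc])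
    thus ?thesis by (rule filterlim_pow_at_top[rotated]) simp
  qed
  have unbounded: "\<exists>T>r. f ((of_real T)\<^sup>2) = 0" for r
  proof -
    obtain j where "r < \<tau> j" using \<tau>_unbounded by blast
    thus ?thesis using fa[of j] by (intro exI[of _ "\<tau> j"]) (simp add: a_def)
  qed
  have aconst: "a_const TYPE('n) = L1_norm (radial f :: real ^ 'n \<Rightarrow> complex) / (2 * V)"
    using a_const_eq_L1_norm[OF extremal] by (simp add: rad V_def)
  have quadrature: "a_const TYPE('n) = \<tau> j ^ CARD('n) * norm (g (a j))"
    if "g holomorphic_on UNIV" "\<And>w. f w = (1 - w / a j) * g w" for g j
    using extremal_quadrature[OF ext that(1) \<tau>pos that(2)[unfolded a_def] unbounded] V
    by (simp add: aconst V_def a_def)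
  have apos: "0 < a_const TYPE('n)" unfolding aconst
    using extremal_L1_norm_pos[OF ext] V by simp
  have anz: "a j \<noteq> 0" for j using \<tau>pos[of j] by (simp add: a_def)
  \<comment> \<open>The quadrature identity at \<open>\<tau> j\<close> has a positive left-hand side, so the quotient does not vanish there.\<close>
  have simple: "deriv f (a j) \<noteq> 0" for j
  proof -
    obtain g where g: "g holomorphic_on UNIV" "\<And>w. f w = (1 - w / a j) * g w"
      using entire_divide_zero[OF hol fa anz] by metis
    have "g (a j) \<noteq> 0" using quadrature[OF g] apos by auto
    thus ?thesis using anz by (simp add: deriv_at_divided_zero[OF g])
  qed
  obtain g where g: "g holomorphic_on UNIV" "\<And>w. f w = (1 - w / a k) * g w"
    using entire_divide_zero[OF hol fa anz] by metis
  have gk: "g (a k) \<noteq> 0" using quadrature[OF g] apos by auto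
  have gz: "g z = 0 \<longleftrightarrow> (\<exists>j. j \<noteq> k \<and> z = a j)" for z
  proof
    assume gz: "g z = 0"
    hence "f z = 0" by (simp add: g(2))
    thus "\<exists>j. j \<noteq> k \<and> z = a j" using zero_imp gk gz by metis
  next
    assume "\<exists>j. j \<noteq> k \<and> z = a j"
    then obtain j where j: "j \<noteq> k" "z = a j" by auto
    have "a j \<noteq> a k" using j(1) inj_a by (auto dest: injD)
    thus "g z = 0" using g(2)[of z] fa[of j] j anz by simp
  qed
  have g0: "g 0 = 1" using g(2)[of 0] f0 by simp
  have prof_g: "radial_profile g"
  proof (rule radial_profile_divide[OF radial_profile_cmult[OF f(1), of "- a k"] g(1)])
    show "- a k * f w = (w - a k) * g w" for w using anz[of k] by (simp add: g(2) field_simps)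
  qed
  obtain A where A: "\<And>w. norm (g w) \<le> A * exp ((1 + 1) * sqrt (norm w))"
    using radial_profile_growth[OF prof_g zero_less_one] by blast
  define S where "S n = a ` ({..n} - {k})" for n
  have "(\<lambda>n. \<Prod>b\<in>S n. 1 - a k / b) \<longlonglongrightarrow> g (a k)"
  proof (rule hadamard_product_simple_zeros[OF g(1) g0 _ A _ _ _ \<tau>_lim])
    show "S n = {z \<in> ball 0 ((\<tau> (Suc n))\<^sup>2). g z = 0}" for n
    proof -
      have "norm (a j) < (\<tau> (Suc n))\<^sup>2 \<longleftrightarrow> j \<le> n" for j
      proof -
        have "norm (a j) = (\<tau> j)\<^sup>2" unfolding a_def norm_of_real by simp
        hence "norm (a j) < (\<tau> (Suc n))\<^sup>2 \<longleftrightarrow> \<not> \<tau> (Suc n) \<le> \<tau> j"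
          using \<tau>pos by (simp add: less_imp_le flip: not_le)
        also have "\<dots> \<longleftrightarrow> j \<le> n"
          using strict_mono_less_eq[OF zeros_increasing, of "Suc n" j] by auto
        finally show ?thesis .
      qed
      thus ?thesis by (auto simp: S_def gz)
    qed
    show "deriv g z \<noteq> 0" if "g z = 0" for z
    proof -
      have "f z = 0" using that by (simp add: g(2))
      then obtain j where "z = a j" using zero_imp by blast
      hence "deriv f z \<noteq> 0" using simple by simp
      thus ?thesis using that by (auto simp: deriv_at_divided_zero[OF g])
    qed
  qed (auto simp: S_def)
  hence "(\<lambda>n. norm (\<Prod>b\<in>S n. 1 - a k / b)) \<longlonglongrightarrow> norm (g (a k))" by (rule tendsto_norm)
  moreover have "norm (\<Prod>b\<in>S n. 1 - a k / b) =
      (\<Prod>j\<le>n. if j = k then 1 else \<bar>1 - (\<tau> k)\<^sup>2 / (\<tau> j)\<^sup>2\<bar>)" for n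
  proof -
    have inj: "inj_on a ({..n} - {k})" using inj_a by (rule inj_on_subset) simp
    have "norm (\<Prod>b\<in>S n. 1 - a k / b) = (\<Prod>j\<in>{..n} - {k}. norm (1 - a k / a j))"
      unfolding S_def by (simp add: prod.reindex[OF inj] prod_norm)
    also have "\<dots> = (\<Prod>j\<in>{..n} - {k}. \<bar>1 - (\<tau> k)\<^sup>2 / (\<tau> j)\<^sup>2\<bar>)"
    proof (rule prod.cong[OF refl])
      fix j
      have "1 - a k / a j = of_real (1 - (\<tau> k)\<^sup>2 / (\<tau> j)\<^sup>2)" by (simp add: a_def)
      thus "norm (1 - a k / a j) = \<bar>1 - (\<tau> k)\<^sup>2 / (\<tau> j)\<^sup>2\<bar>" by (simp only: norm_of_real)
    qed
    also have "\<dots> = (\<Prod>j\<le>n. if j = k then 1 else \<bar>1 - (\<tau> k)\<^sup>2 / (\<tau> j)\<^sup>2\<bar>)"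
      by (rule prod.mono_neutral_cong_left) auto
    finally show ?thesis .
  qed
  ultimately have raw: "raw_has_prod (\<lambda>j. if j = k then 1 else \<bar>1 - (\<tau> k)\<^sup>2 / (\<tau> j)\<^sup>2\<bar>) 0 (norm (g (a k)))"
    using gk unfolding raw_has_prod_def add_0_right by simp
  hence hp: "(\<lambda>j. if j = k then 1 else \<bar>1 - (\<tau> k)\<^sup>2 / (\<tau> j)\<^sup>2\<bar>) has_prod norm (g (a k))"
    by (simp add: has_prod_def)
  hence "(\<Prod>j. if j = k then 1 else \<bar>1 - (\<tau> k)\<^sup>2 / (\<tau> j)\<^sup>2\<bar>) = norm (g (a k))"
    using has_prod_unique by metis
  moreover have "convergent_prod (\<lambda>j. if j = k then 1 else \<bar>1 - (\<tau> k)\<^sup>2 / (\<tau> j)\<^sup>2\<bar>)"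
    using raw unfolding convergent_prod_def by blast
  ultimately show ?thesis using quadrature[OF g] by simp
qed

end
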